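(* Let $\mathcal D_0$ be an ordered, oriented Descartes configuration. Let $\Sigma$ be the set of points of $\hat{\mathbb C}$ lying on at least two distinct circles that occur in configurations of the orbit $\mathcal A^\perp(\mathcal D_0)=\{\mathcal D:\mathbf W_{\mathcal D}=\mathbf U\mathbf W_{\mathcal D_0},\ \mathbf U\in\mathcal A^\perp\}$. Let $\mathcal D_0^\perp$ be the ordered, oriented Descartes configuration with $\mathbf W_{\mathcal D_0^\perp}=\mathbf D\mathbf W_{\mathcal D_0}$. Then the closure $\overline{\Sigma}$ equals the residual set $\Lambda(\mathcal P_{\mathcal D_0^\perp})$ of the Apollonian packing generated by $\mathcal D_0^\perp$.
   Context: Oriented circles/lines and oriented Descartes configurations: four mutually tangent oriented circles/lines with six distinct tangency points whose interiors are pairwise disjoint or become so after reversing all orientations. Augmented curvature-center coordinates: for center $\mathbf c$, oriented radius $r$: $\mathbf w(C)=((|\mathbf c|^2-r^2)/r,1/r,c_1/r,c_2/r)$; for the line $\mathbf x\cdot\mathbf h=m$ with interior-pointing unit normal $\mathbf h$: $(2m,0,h_1,h_2)$; $\mathbf W_{\mathcal D}$ has rows $\mathbf w(C_k)$; $\mathcal D\mapsto\mathbf W_{\mathcal D}$ is a bijection onto $\{\mathbf W:\mathbf W^T\mathbf Q_D\mathbf W=\mathbf Q_W\}$ ($\mathbf Q_D=\mathbf I-\frac12\mathbf 1\mathbf 1^T$, $\mathbf Q_W=\begin{pmatrix}0&-4&0&0\\-4&0&0&0\\0&0&2&0\\0&0&0&2\end{pmatrix}$). $\mathcal A^\perp=\langle\mathbf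 S_1^\perp,\dots,\mathbf S_4^\perp\rangle$, where $\mathbf S_i^\perp$ agrees with the identity except in column $i$, which has $-1$ in position $i$ and $2$ elsewhere. $\mathbf D=\tfrac12(\mathbf 1\mathbf 1^T)-2\cdot\tfrac12\mathbf I$, i.e. diagonal entries $-1/2$, off-diagonal $1/2$. Apollonian packing $\mathcal P_{\mathcal D}$: the set of all circles occurring in Descartes configurations obtained from $\mathcal D$ by finitely many replacements of one circle $C_i$ by the unique other circle tangent to the remaining three at new points. Residual set $\Lambda(\mathcal P)$: the closure in $\hat{\mathbb C}$ of the union of all circles of $\mathcal P$. *)

theory Defs
  imports "HOL-Analysis.Analysis"
begin

text \<open>OCirc c r: circle with centre c and oriented (signed) radius r (r > 0: interior is the
 bounded disk; r < 0: interior is the outside, containing infinity).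
 OLine h m: the line x . h = m with unit normal h (as a complex number) pointing into the interior.\<close>

datatype ocircle = OCirc complex real | OLine complex real

fun valid_oc :: "ocircle \<Rightarrow> bool" where
  "valid_oc (OCirc c r) = (r \<noteq> 0)"
| "valid_oc (OLine h m) = (cmod h = 1)"

fun reverse_oc :: "ocircle \<Rightarrow> ocircle" where
  "reverse_oc (OCirc c r) = OCirc c (- r)"
| "reverse_oc (OLine h m) = OLine (- h) (- m)"

text \<open>The extended complex plane is modelled as the unit sphere in R^3 via inverse
 stereographic projection; the north pole is the point at infinity.\<close>

definition stereo :: "complex \<Rightarrow> real^3" where
  "stereo z = (\<chi> i. if i = 1 then 2 * Re z / ((cmod z)\<^sup>2 + 1)
                 else if i = 2 then 2 * Im z / ((cmod z)\<^sup>2 + 1)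
                 else ((cmod z)\<^sup>2 - 1) / ((cmod z)\<^sup>2 + 1))"

definition npole :: "real^3" where
  "npole = (\<chi> i. if i = 3 then 1 else 0)"

fun planar_pts :: "ocircle \<Rightarrow> complex set" where
  "planar_pts (OCirc c r) = {z. cmod (z - c) = \<bar>r\<bar>}"
| "planar_pts (OLine h m) = {z. Re z * Re h + Im z * Im h = m}"

fun pts :: "ocircle \<Rightarrow> (real^3) set" where
  "pts (OCirc c r) = stereo ` {z. cmod (z - c) = \<bar>r\<bar>}"
| "pts (OLine h m) = stereo ` {z. Re z * Re h + Im z * Im h = m} \<union> {npole}"

fun int_pts :: "ocircle \<Rightarrow> (real^3) set" where
  "int_pts (OCirc c r) =
     (if r > 0 then stereo ` {z. cmod (z - c) < r}
      else stereo ` {z. cmod (z - c) > - r} \<union> {npole})"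
| "int_pts (OLine h m) = stereo ` {z. Re z * Re h + Im z * Im h > m}"

definition tangent_oc :: "ocircle \<Rightarrow> ocircle \<Rightarrow> bool" where
  "tangent_oc C1 C2 \<longleftrightarrow> (\<exists>!p. p \<in> pts C1 \<and> p \<in> pts C2)"

definition tpoint :: "ocircle \<Rightarrow> ocircle \<Rightarrow> real^3" where
  "tpoint C1 C2 = (THE p. p \<in> pts C1 \<and> p \<in> pts C2)"

definition descartes :: "ocircle^4 \<Rightarrow> bool" where
  "descartes D \<longleftrightarrow>
     (\<forall>i. valid_oc (D $ i)) \<and>
     (\<forall>i j. i \<noteq> j \<longrightarrow> tangent_oc (D $ i) (D $ j)) \<and>
     (\<forall>i j k l. i \<noteq> j \<longrightarrow> k \<noteq> l \<longrightarrow> {i, j} \<noteq> {k, l} \<longrightarrow>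
        tpoint (D $ i) (D $ j) \<noteq> tpoint (D $ k) (D $ l)) \<and>
     ((\<forall>i j. i \<noteq> j \<longrightarrow> int_pts (D $ i) \<inter> int_pts (D $ j) = {}) \<or>
      (\<forall>i j. i \<noteq> j \<longrightarrow> int_pts (reverse_oc (D $ i)) \<inter> int_pts (reverse_oc (D $ j)) = {}))"

fun wvec :: "ocircle \<Rightarrow> real^4" where
  "wvec (OCirc c r) = (\<chi> j. if j = 1 then ((cmod c)\<^sup>2 - r\<^sup>2) / r
                          else if j = 2 then 1 / r
                          else if j = 3 then Re c / r else Im c / r)"
| "wvec (OLine h m) = (\<chi> j. if j = 1 then 2 * m
                          else if j = 2 then 0
                          else if j = 3 then Re h else Im h)"

definition Wmat :: "ocircle^4 \<Rightarrow> real^4^4" where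
  "Wmat D = (\<chi> k. wvec (D $ k))"

definition Sperp :: "4 \<Rightarrow> real^4^4" where
  "Sperp i = (\<chi> r c. if c = i then (if r = i then -1 else 2) else (if r = c then 1 else 0))"

inductive_set Aperp :: "(real^4^4) set" where
  id: "mat 1 \<in> Aperp"
| gen: "Sperp i \<in> Aperp"
| mult: "U \<in> Aperp \<Longrightarrow> V \<in> Aperp \<Longrightarrow> U ** V \<in> Aperp"
| inv: "U \<in> Aperp \<Longrightarrow> matrix_inv U \<in> Aperp"

definition Dmat :: "real^4^4" where
  "Dmat = (\<chi> r c. if r = c then - 1 / 2 else 1 / 2)"

definition orbit_Aperp :: "ocircle^4 \<Rightarrow> (ocircle^4) set" where
  "orbit_Aperp D0 = {D. descartes D \<and> (\<exists>U \<in> Aperp. Wmat D = U ** Wmat D0)}"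

definition Sigma_pts :: "ocircle^4 \<Rightarrow> (real^3) set" where
  "Sigma_pts D0 = {p. \<exists>D1 \<in> orbit_Aperp D0. \<exists>D2 \<in> orbit_Aperp D0. \<exists>i j.
      pts (D1 $ i) \<noteq> pts (D2 $ j) \<and> p \<in> pts (D1 $ i) \<and> p \<in> pts (D2 $ j)}"

inductive_set apoll_reach :: "ocircle^4 \<Rightarrow> (ocircle^4) set" for D0 where
  base: "D0 \<in> apoll_reach D0"
| step: "E \<in> apoll_reach D0 \<Longrightarrow> descartes E' \<Longrightarrow> (\<forall>j. j \<noteq> i \<longrightarrow> E' $ j = E $ j) \<Longrightarrow>
         pts (E' $ i) \<noteq> pts (E $ i) \<Longrightarrow> E' \<in> apoll_reach D0"

definition apoll_packing :: "ocircle^4 \<Rightarrow> ocircle set" where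
  "apoll_packing D0 = {E $ i | E i. E \<in> apoll_reach D0}"

definition residual_set :: "ocircle^4 \<Rightarrow> (real^3) set" where
  "residual_set D0 = closure (\<Union>C \<in> apoll_packing D0. pts C)"

end

theory Submission
  imports Defs
begin

text \<open>In Lorentzian coordinates circles are unit spacelike vectors, points are null vectors, and
  the rows of a Descartes configuration are four vectors with Gram matrix \<open>2 Q\<^sub>D\<close>. The generators
  of \<open>Aperp\<close> act by inverting a configuration in one of its own circles, and \<open>Dmat\<close> conjugates
  them to the Apollonian moves; so the packing consists of the duals of the configurations of the
  orbit, whose circles pass through the tangency points of those configurations.

  Ping-pong with the four disjoint discs shows that two distinct circles of the orbit can only meet
  in a tangency point of one of its configurations. Conversely, on a circle dual to a configuration
  \<open>W\<close> take a point whose products with the vectors of \<open>W\<close> have rational ratios. After clearing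
  denominators, an integral descent by inversions moves \<open>W\<close> to a configuration having the point
  as a tangency point. Such points are dense in the dual circle.\<close>

subsection \<open>Descartes configurations in Lorentz space\<close>

type_synonym lvec = "(real^3) \<times> real"

definition lform :: "lvec \<Rightarrow> lvec \<Rightarrow> real" where
  "lform x y = fst x \<bullet> fst y - snd x * snd y"

lemma lform_commute: "lform x y = lform y x"
  by (simp add: lform_def inner_commute mult.commute)

lemma lform_add_left [simp]: "lform (x + y) z = lform x z + lform y z"
  and lform_diff_left [simp]: "lform (x - y) z = lform x z - lform y z"
  and lform_minus_left [simp]: "lform (- x) z = - lform x z"
  and lform_scaleR_left [simp]: "lform (a *\<^sub>R x) z = a * lform x z"
  and lform_zero_left [simp]: "lform 0 z = 0"
  by (simp_all add: lform_def algebra_simps inner_simps)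

lemma lform_add_right [simp]: "lform z (x + y) = lform z x + lform z y"
  and lform_diff_right [simp]: "lform z (x - y) = lform z x - lform z y"
  and lform_minus_right [simp]: "lform z (- x) = - lform z x"
  and lform_scaleR_right [simp]: "lform z (a *\<^sub>R x) = a * lform z x"
  and lform_zero_right [simp]: "lform z 0 = 0"
  by (simp_all add: lform_commute[of z x] lform_commute[of z y] lform_commute[of z "x + y"]
      lform_commute[of z "x - y"] lform_commute[of z "- x"] lform_commute[of z "a *\<^sub>R x"]
      lform_commute[of z 0])

lemma lform_sum_left: "lform (sum f A) z = (\<Sum>i\<in>A. lform (f i) z)"
  by (induction A rule: infinite_finite_induct) auto

lemma lform_sum_right: "lform z (sum f A) = (\<Sum>i\<in>A. lform z (f i))"
  by (induction A rule: infinite_finite_induct) auto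

lemma lform_nondegenerate:
  assumes "\<And>y. lform x y = 0"
  shows "x = 0"
proof -
  have "fst x \<bullet> fst x = 0" "snd x * snd x = 0"
    using assms[of "(fst x, 0)"] assms[of "(0, snd x)"] by (simp_all add: lform_def)
  then show ?thesis by (simp add: prod_eq_iff)
qed

text \<open>For \<open>lform w w = 1\<close> this is the orthogonal reflection in the hyperplane
  orthogonal to \<open>w\<close>; on null directions, that is on points of the sphere, it acts as
  inversion in the circle of \<open>w\<close>.\<close>

definition lrefl :: "lvec \<Rightarrow> lvec \<Rightarrow> lvec" where
  "lrefl w x = x - (2 * lform x w) *\<^sub>R w"

lemma lrefl_simps [simp]:
  "lrefl w (x + y) = lrefl w x + lrefl w y"
  "lrefl w (a *\<^sub>R x) = a *\<^sub>R lrefl w x"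
  "lrefl w (- x) = - lrefl w x"
  by (simp_all add: lrefl_def algebra_simps)

lemma lrefl_involution:
  assumes "lform w w = 1"
  shows "lrefl w (lrefl w x) = x"
  using assms by (simp add: lrefl_def algebra_simps)

lemma lform_lrefl:
  assumes "lform w w = 1"
  shows "lform (lrefl w x) (lrefl w y) = lform x y"
  using assms by (simp add: lrefl_def lform_commute[of w y] algebra_simps)

lemma lform_lrefl_swap:
  "lform (lrefl w x) y = lform x (lrefl w y)"
  by (simp add: lrefl_def lform_commute[of w y])

lemma null_norm:
  assumes "lform x x = 0"
  shows "norm (fst x) = \<bar>snd x\<bar>"
  using assms by (simp add: lform_def norm_eq_sqrt_inner)

lemma lform_null_le_0:
  assumes "lform x x = 0" "snd x > 0" "lform y y = 0" "snd y > 0"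
  shows "lform x y \<le> 0"
  using norm_cauchy_schwarz[of "fst x" "fst y"] assms null_norm[of x] null_norm[of y]
  by (simp add: lform_def)

text \<open>Equality case of Cauchy-Schwarz: orthogonal null vectors are proportional. The squared
  distance of the two points expands to 0.\<close>

lemma null_orthogonal_eq:
  assumes "lform x x = 0" "snd x \<noteq> 0" "norm p = 1" "lform x (p, 1) = 0"
  shows "p = (1 / snd x) *\<^sub>R fst x"
proof -
  have x: "fst x \<bullet> fst x = snd x * snd x" "fst x \<bullet> p = snd x" "p \<bullet> fst x = snd x"
    using assms by (auto simp: lform_def inner_commute)
  have p: "p \<bullet> p = 1" using assms by (simp add: norm_eq_1)
  have "(p - (1 / snd x) *\<^sub>R fst x) \<bullet> (p - (1 / snd x) *\<^sub>R fst x) = 0"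
    using assms(2) x p by (simp add: inner_diff_left inner_diff_right field_simps)
  then show ?thesis by simp
qed

text \<open>Reflections keep the future light cone. If the image \<open>y\<close> fell into the
  past, \<open>lform x (- y) \<le> 0\<close>, although it is twice the square of
  \<open>lform x w\<close>; so \<open>lform x w = 0\<close> and \<open>y = x\<close>.\<close>

lemma snd_lrefl_pos:
  assumes w: "lform w w = 1" and x: "lform x x = 0" "snd x > 0"
  shows "snd (lrefl w x) > 0"
proof (rule ccontr)
  let ?y = "lrefl w x"
  assume "\<not> snd ?y > 0"
  then consider "snd ?y = 0" | "snd ?y < 0" by linarith
  then show False
  proof cases
    case 1
    have "lform ?y ?y = 0" using lform_lrefl[OF w] x by simp
    then have "?y = 0" using 1 by (simp add: prod_eq_iff lform_def)
    then have "lrefl w ?y = 0" by (simp add: lrefl_def)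
    then show False using lrefl_involution[OF w] x by auto
  next
    case 2
    have "lform x (- ?y) \<le> 0"
      using lform_null_le_0[of x "- ?y"] 2 x lform_lrefl[OF w] by simp
    then have "2 * (lform x w)\<^sup>2 \<le> 0"
      using x by (simp add: lrefl_def power2_eq_square)
    then have "lform x w = 0" by simp
    then show False using 2 x by (simp add: lrefl_def)
  qed
qed

definition lpts :: "lvec \<Rightarrow> (real^3) set" where
  "lpts w = {p. norm p = 1 \<and> lform w (p, 1) = 0}"

lemma lpts_minus [simp]: "lpts (- w) = lpts w"
  by (simp add: lpts_def)

definition lproj :: "lvec \<Rightarrow> real^3" where
  "lproj x = (1 / snd x) *\<^sub>R fst x"

lemma lproj_in_lpts:
  assumes "lform x x = 0" "snd x \<noteq> 0"
  shows "lproj x \<in> lpts w \<longleftrightarrow> lform w x = 0"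
  using assms null_norm[OF assms(1)]
  by (auto simp: lpts_def lproj_def lform_def field_simps)

section \<open>Configurations of four vectors and their duals\<close>

definition lconf :: "(4 \<Rightarrow> lvec) \<Rightarrow> bool" where
  "lconf W \<longleftrightarrow> (\<forall>i j. lform (W i) (W j) = (if i = j then 1 else - 1))"

lemma lconf_same: "lconf W \<Longrightarrow> lform (W i) (W i) = 1"
  and lconf_diff: "lconf W \<Longrightarrow> i \<noteq> j \<Longrightarrow> lform (W i) (W j) = - 1"
  by (simp_all add: lconf_def)

lemma sum_gram:
  fixes u :: "4 \<Rightarrow> real"
  shows "(\<Sum>i\<in>UNIV. u i * (if i = j then 1 else - 1)) = 2 * u j - sum u UNIV"
proof -
  have "(\<Sum>i\<in>UNIV. u i * (if i = j then 1 else - 1))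
      = (\<Sum>i\<in>UNIV. (if i = j then 2 * u i else 0) - u i)"
    by (intro sum.cong) auto
  then show ?thesis by (simp add: sum_subtractf)
qed

lemma lconf_lform_comb:
  assumes "lconf W"
  shows "lform (\<Sum>i\<in>UNIV. u i *\<^sub>R W i) (W j) = 2 * u j - sum u UNIV"
  using assms sum_gram[of u j] by (simp add: lform_sum_left lconf_def)

lemma lconf_lform_sum:
  assumes "lconf W"
  shows "lform (sum W UNIV) (W j) = - 2"
  using lconf_lform_comb[OF assms, of "\<lambda>_. 1" j] by simp

text \<open>The action of \<open>Dmat\<close> on rows. For \<open>lconf W\<close>,
  \<open>ldual W k\<close> is orthogonal to the other three vectors, so its circle passes through
  the three tangency points among them.\<close>

definition ldual :: "(4 \<Rightarrow> lvec) \<Rightarrow> 4 \<Rightarrow> lvec" where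
  "ldual W = (\<lambda>k. (1 / 2) *\<^sub>R sum W UNIV - W k)"

lemma lform_ldual:
  assumes "lconf W"
  shows "lform (ldual W k) (W j) = (if j = k then - 2 else 0)"
  using assms lconf_lform_sum[OF assms, of j]
  by (auto simp: ldual_def lconf_def)

lemma lconf_ldual:
  assumes "lconf W"
  shows "lconf (ldual W)"
proof -
  have "lform (ldual W k) (sum W UNIV) = - 2" for k
    by (simp add: lform_sum_right lform_ldual[OF assms])
  then have "lform (ldual W k) (ldual W j) = (if k = j then 1 else - 1)" for k j
    using lform_ldual[OF assms, of k j]
    by (subst (2) ldual_def) auto
  then show ?thesis by (simp add: lconf_def)
qed

lemma lconf_inj:
  assumes "lconf W"
  shows "inj W"
proof (rule injI)
  fix i j assume "W i = W j"
  then show "i = j"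
    using lconf_same[OF assms, of i] lconf_diff[OF assms, of i j] by force
qed

lemma lconf_orthogonal_eq_0:
  assumes W: "lconf W" and x: "\<And>j. lform x (W j) = 0"
  shows "x = 0"
proof (rule lform_nondegenerate)
  fix y
  have sub: "subspace {z. lform v z = 0}" for v
    by (rule subspaceI) auto
  have indep: "independent (range W)"
    unfolding dependent_def
  proof (rule notI, elim bexE)
    fix v
    assume "v \<in> range W" "v \<in> span (range W - {v})"
    then obtain i where "W i \<in> span (range W - {W i})" by blast
    \<comment> \<open>Pairing with \<open>ldual W i\<close> kills the other three vectors but not
      \<open>W i\<close>.\<close>
    moreover have "span (range W - {W i}) \<subseteq> {z. lform (ldual W i) z = 0}"
      by (rule span_minimal[OF _ sub]) (auto simp: lform_ldual[OF W])
    ultimately show False by (auto simp: lform_ldual[OF W])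
  qed
  have "card (range W) = 4"
    using lconf_inj[OF W] by (simp add: card_image)
  then have "UNIV \<subseteq> span (range W)"
    using indep by (intro card_ge_dim_independent) auto
  moreover have "span (range W) \<subseteq> {z. lform x z = 0}"
    using x by (intro span_minimal sub) auto
  ultimately show "lform x y = 0" by auto
qed

lemma lconf_eqI:
  assumes "lconf W" "\<And>j. lform x (W j) = lform y (W j)"
  shows "x = y"
  using lconf_orthogonal_eq_0[OF assms(1), of "x - y"] assms(2) by simp

text \<open>\<open>Q\<^sub>D\<close> is its own inverse, so the Gram matrix
  \<open>2 Q\<^sub>D\<close> has inverse \<open>Q\<^sub>D / 2\<close>, which turns products with the
  basis into coordinates.\<close>

lemma lconf_expand:
  fixes x :: lvec
  assumes W: "lconf W"
  defines "f \<equiv> \<lambda>i. lform x (W i)"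
  shows "x = (1 / 4) *\<^sub>R (\<Sum>i\<in>UNIV. (2 * f i - sum f UNIV) *\<^sub>R W i)"
proof (rule lconf_eqI[OF W])
  fix j
  show "lform x (W j)
      = lform ((1 / 4) *\<^sub>R (\<Sum>i\<in>UNIV. (2 * f i - sum f UNIV) *\<^sub>R W i)) (W j)"
    by (simp add: lconf_lform_comb[OF W] sum_subtractf sum_distrib_left[symmetric] f_def)
qed

text \<open>A form of the Descartes circle theorem: for null \<open>x\<close> the four products
  satisfy the quadratic relation of the curvatures of four mutually tangent circles.\<close>

lemma lconf_lform_square:
  fixes x :: lvec
  assumes W: "lconf W"
  defines "f \<equiv> \<lambda>i. lform x (W i)"
  shows "4 * lform x x = 2 * (\<Sum>i\<in>UNIV. (f i)\<^sup>2) - (sum f UNIV)\<^sup>2"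
proof -
  have "lform x x = lform x ((1 / 4) *\<^sub>R (\<Sum>i\<in>UNIV. (2 * f i - sum f UNIV) *\<^sub>R W i))"
    using lconf_expand[OF W, of x] by (simp add: f_def)
  also have "\<dots> = (1 / 4) * (\<Sum>i\<in>UNIV. (2 * f i - sum f UNIV) * f i)"
    by (simp add: lform_sum_right f_def)
  finally show ?thesis
    by (simp add: left_diff_distrib sum_subtractf sum_distrib_left power2_eq_square mult.assoc)
qed

section \<open>The generators as reflections, and their orbit\<close>

definition lmove :: "4 \<Rightarrow> (4 \<Rightarrow> lvec) \<Rightarrow> 4 \<Rightarrow> lvec" where
  "lmove i W = (\<lambda>k. if k = i then - W i else W k + 2 *\<^sub>R W i)"

text \<open>Because \<open>lform (W k) (W i) = - 1\<close> for \<open>k \<noteq> i\<close>, adding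
  \<open>2 *\<^sub>R W i\<close> is exactly reflection in \<open>W i\<close>.\<close>

lemma lmove_eq_lrefl:
  assumes "lconf W"
  shows "lmove i W k = lrefl (W i) (W k)"
  using lconf_same[OF assms, of i] lconf_diff[OF assms, of k i]
  by (auto simp: lmove_def lrefl_def algebra_simps scaleR_2)

text \<open>Reflections are linear, so they commute with moves. Hence a sequence of moves, each in a
  circle of the current configuration, becomes a word of reflections in the four fixed circles of
  the initial one.\<close>

lemma lmove_lrefl: "lmove k (\<lambda>j. lrefl w (V j)) = (\<lambda>j. lrefl w (lmove k V j))"
  by (auto simp: lmove_def)

lemma lmove_lmove [simp]: "lmove i (lmove i W) = W"
  by (auto simp: lmove_def)

lemma lconf_lmove:
  assumes "lconf W"
  shows "lconf (lmove i W)"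
  using assms lform_lrefl[OF lconf_same[OF assms]]
  by (simp add: lconf_def lmove_eq_lrefl[OF assms])

lemma sum_lmove: "sum (lmove i W) UNIV = sum W UNIV + 4 *\<^sub>R W i"
proof -
  have "sum (lmove i W) UNIV
      = (\<Sum>k\<in>UNIV. W k + 2 *\<^sub>R W i + (if k = i then - (4 *\<^sub>R W i) else 0))"
    by (intro sum.cong) (auto simp: lmove_def prod_eq_iff vec_eq_iff)
  also have "\<dots> = sum W UNIV + (8 *\<^sub>R W i - 4 *\<^sub>R W i)"
    by (simp add: sum.distrib sum_constant_scaleR)
  finally show ?thesis by (simp add: scaleR_left_diff_distrib[symmetric])
qed

text \<open>The Apollonian move on rows: \<open>W i\<close> becomes twice the sum of the other three
  minus \<open>W i\<close>.\<close>

definition lswap :: "4 \<Rightarrow> (4 \<Rightarrow> lvec) \<Rightarrow> 4 \<Rightarrow> lvec" where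
  "lswap i W = W(i := 2 *\<^sub>R sum W UNIV - 3 *\<^sub>R W i)"

lemma ldual_lmove: "ldual (lmove i W) = lswap i (ldual W)"
proof
  fix k
  have s: "sum (ldual W) UNIV = sum W UNIV"
    by (simp add: ldual_def sum_subtractf sum_constant_scaleR scaleR_2)
  show "ldual (lmove i W) k = lswap i (ldual W) k"
    unfolding lswap_def s fun_upd_apply
    by (auto simp: ldual_def sum_lmove) (auto simp: lmove_def prod_eq_iff vec_eq_iff field_simps)
qed

lemma ldual_lmove_other: "k \<noteq> i \<Longrightarrow> ldual (lmove i W) k = ldual W k"
  by (simp add: ldual_lmove lswap_def)

text \<open>Each move is an involution, so closure under the moves is already a group orbit.\<close>

inductive_set lorbit :: "(4 \<Rightarrow> lvec) \<Rightarrow> (4 \<Rightarrow> lvec) set" for W where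
  lorbit_refl: "W \<in> lorbit W"
| lorbit_step: "V \<in> lorbit W \<Longrightarrow> lmove i V \<in> lorbit W"

lemma lorbit_trans:
  assumes "V \<in> lorbit U" "U \<in> lorbit W"
  shows "V \<in> lorbit W"
  using assms by (induction) (auto intro: lorbit.intros)

lemma lorbit_sym:
  assumes "V \<in> lorbit W"
  shows "W \<in> lorbit V"
  using assms
proof induction
  case (lorbit_step V i)
  have "V \<in> lorbit (lmove i V)"
    using lorbit.lorbit_step[OF lorbit_refl, of i "lmove i V"] by simp
  then show ?case using lorbit_step.IH lorbit_trans by blast
qed (rule lorbit_refl)

lemma lconf_lorbit:
  assumes "V \<in> lorbit W" "lconf W"
  shows "lconf V"
  using assms by induction (auto intro: lconf_lmove)

section \<open>Tangency points as null vectors\<close>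

definition ltangent :: "(4 \<Rightarrow> lvec) \<Rightarrow> 4 \<Rightarrow> 4 \<Rightarrow> real^3" where
  "ltangent W i j = lproj (W i + W j)"

lemma ex_other: "\<exists>k::4. k \<noteq> i \<and> k \<noteq> j"
proof -
  have "card {i, j} \<le> 2" by (simp add: card_insert_if)
  moreover have "CARD(4) = 4" by simp
  ultimately have "{i, j} \<noteq> UNIV" by (intro notI) simp
  then show ?thesis by blast
qed

text \<open>The four products \<open>1 - 1 - 1 + 1\<close> cancel. A null vector with vanishing last
  component is zero, which the product \<open>- 2\<close> with a third vector excludes.\<close>

lemma tangency_null:
  assumes "lconf W" "i \<noteq> j"
  shows "lform (W i + W j) (W i + W j) = 0" "snd (W i + W j) \<noteq> 0"
proof -
  show null: "lform (W i + W j) (W i + W j) = 0"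
    using assms by (simp add: lconf_def)
  show "snd (W i + W j) \<noteq> 0"
  proof
    assume "snd (W i + W j) = 0"
    then have z: "W i + W j = 0"
      using null_norm[OF null] by (simp add: prod_eq_iff)
    obtain k where "k \<noteq> i" "k \<noteq> j" using ex_other by blast
    then have "lform (W i + W j) (W k) = - 2" using assms by (simp add: lconf_def)
    then show False using z by simp
  qed
qed

lemma ltangent_in_lpts:
  assumes "lconf W" "i \<noteq> j"
  shows "ltangent W i j \<in> lpts w \<longleftrightarrow> lform w (W i) + lform w (W j) = 0"
  unfolding ltangent_def using lproj_in_lpts[OF tangency_null[OF assms]] by simp

lemma lpts_Int:
  assumes "lconf W" "i \<noteq> j"
  shows "p \<in> lpts (W i) \<and> p \<in> lpts (W j) \<longleftrightarrow> p = ltangent W i j"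
proof
  assume "p \<in> lpts (W i) \<and> p \<in> lpts (W j)"
  then show "p = ltangent W i j"
    unfolding ltangent_def lproj_def
    by (intro null_orthogonal_eq tangency_null assms) (auto simp: lpts_def)
next
  assume "p = ltangent W i j"
  then show "p \<in> lpts (W i) \<and> p \<in> lpts (W j)"
    using assms by (simp add: ltangent_in_lpts lconf_def)
qed

lemma ltangent_notin:
  assumes "lconf W" "i \<noteq> j" "k \<noteq> i" "k \<noteq> j"
  shows "ltangent W i j \<notin> lpts (W k)"
  using assms by (simp add: ltangent_in_lpts lconf_def)

lemma ltangent_in_ldual:
  assumes "lconf W" "i \<noteq> j" "k \<noteq> i" "k \<noteq> j"
  shows "ltangent W i j \<in> lpts (ldual W k)"
  using assms by (simp add: ltangent_in_lpts lform_ldual)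

lemma lpts_neq:
  assumes "lconf W" "i \<noteq> j"
  shows "lpts (W i) \<noteq> lpts (W j)"
proof -
  obtain k where k: "k \<noteq> i" "k \<noteq> j" using ex_other by blast
  then have "ltangent W i k \<in> lpts (W i)" "ltangent W i k \<notin> lpts (W j)"
    using assms lpts_Int[of W i k] ltangent_notin[of W i k j] by auto
  then show ?thesis by auto
qed

text \<open>Null vectors of different pairs have product \<open>- 2\<close> or \<open>- 4\<close>,
  whereas null vectors in opposite half-cones have nonnegative product.\<close>

lemma tangency_same_sign:
  assumes W: "lconf W" and "i \<noteq> j" "k \<noteq> l"
  shows "snd (W i + W j) > 0 \<longleftrightarrow> snd (W k + W l) > 0"
proof -
  have *: "snd (W k + W l) > 0" if "snd (W i + W j) > 0" "i \<noteq> j" "k \<noteq> l" for i j k l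
  proof (rule ccontr)
    assume "\<not> ?thesis"
    then have neg: "snd (- (W k + W l)) > 0"
      using tangency_null(2)[OF W \<open>k \<noteq> l\<close>] by auto
    have "lform (W i + W j) (- (W k + W l)) \<le> 0"
      using lform_null_le_0[OF tangency_null(1)[OF W \<open>i \<noteq> j\<close>] that(1) _ neg]
        tangency_null(1)[OF W \<open>k \<noteq> l\<close>] by simp
    moreover have "{i, j} = {k, l} \<Longrightarrow> W i + W j = W k + W l"
      by (auto simp: doubleton_eq_iff)
    moreover have "lform (W i + W j) (W k + W l) < 0 \<or> {i, j} = {k, l}"
      using that W by (auto simp: lconf_def)
    ultimately show False using neg that(1) by auto
  qed
  show ?thesis using *[of i j k l] *[of k l i j] assms by blast
qed

text \<open>\<open>e\<close> is the global orientation: the caps of the vectors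
  \<open>e *\<^sub>R W i\<close> are pairwise disjoint (\<open>disjoint_caps\<close>).\<close>

lemma tangency_sign:
  assumes W: "lconf W"
  obtains e :: real where "e = 1 \<or> e = - 1" "\<And>i j. i \<noteq> j \<Longrightarrow> snd (e *\<^sub>R (W i + W j)) > 0"
proof (cases "snd (W 1 + W 2) > 0")
  case True
  then show ?thesis
    using that[of 1] tangency_same_sign[OF W, of 1 2] by auto
next
  case False
  have "snd ((- 1) *\<^sub>R (W i + W j)) > 0" if "i \<noteq> j" for i j
    using tangency_same_sign[OF W, of 1 2 i j] tangency_null(2)[OF W that] that False by auto
  then show ?thesis using that[of "- 1"] by blast
qed

section \<open>Ping-pong for the circles of the orbit\<close>

text \<open>The images of \<open>W a\<close> under reduced words of reflections, sorted by the first letter.\<close>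

inductive reduced_image :: "(4 \<Rightarrow> lvec) \<Rightarrow> 4 \<Rightarrow> lvec \<Rightarrow> bool" for W where
  base: "reduced_image W a (W a)"
| step: "reduced_image W b x \<Longrightarrow> b \<noteq> a \<Longrightarrow> reduced_image W a (lrefl (W a) x)"

text \<open>Ping-pong: the circle with vector \<open>x\<close> lies in the closed disc bounded by \<open>W a\<close>.\<close>

lemma reduced_image_nested:
  assumes W: "lconf W" and e: "\<And>i j. i \<noteq> j \<Longrightarrow> snd (e *\<^sub>R (W i + W j)) > 0"
    and "reduced_image W a x" "lform x n = 0" "lform n n = 0" "snd n > 0"
  shows "e * lform (W a) n \<ge> 0"
  using assms(3-)
proof (induction arbitrary: n)
  case (step b x a)
  \<comment> \<open>Undo the first letter: \<open>?m\<close> is orthogonal to the vector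
    \<open>x\<close> of the shorter word, so it lies in the disc of \<open>W b\<close>, hence
    outside the open disc of \<open>W a\<close>; reflecting back moves it into the closed disc of
    \<open>W a\<close>.\<close>
  let ?m = "lrefl (W a) n"
  have aa: "lform (W a) (W a) = 1" using W by (simp add: lconf_def)
  have m: "lform ?m ?m = 0" "snd ?m > 0"
    using step.prems lform_lrefl[OF aa] snd_lrefl_pos[OF aa] by simp_all
  have "lform x ?m = 0" using step.prems by (simp add: lform_lrefl_swap)
  then have "e * lform (W b) ?m \<ge> 0" using step.IH m by blast
  moreover have "lform (e *\<^sub>R (W a + W b)) ?m \<le> 0"
    using e[of a b] step.hyps m tangency_null(1)[OF W, of a b]
    by (intro lform_null_le_0) (simp_all only: lform_scaleR_left lform_scaleR_right)
  moreover have "lform (W a) ?m = - lform (W a) n"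
    using aa by (simp add: lrefl_def lform_commute[of n])
  ultimately show ?case by (simp add: algebra_simps)
qed auto

text \<open>Put in front of a reduced word, a letter either extends it, cancels its equal first
  letter, or, on the bare vector \<open>W i\<close>, only changes the sign.\<close>

lemma lorbit_reduced_image:
  assumes W: "lconf W" and "V \<in> lorbit W"
  shows "\<exists>a x. reduced_image W a x \<and> (V j = x \<or> V j = - x)"
proof -
  \<comment> \<open>\<open>S n\<close> holds the images of \<open>W\<close> under words of
    \<open>n\<close> reflections in the circles of \<open>W\<close> itself; by \<open>move\<close>,
    a move adds one letter at the inner end.\<close>
  define S where "S = rec_nat {W} (\<lambda>_ S. {\<lambda>j. lrefl (W i) (V j) | i V. V \<in> S})"
  have S_0: "S 0 = {W}" and S_Suc: "S (Suc n) = {\<lambda>j. lrefl (W i) (V j) | i V. V \<in> S n}" for n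
    by (simp_all add: S_def)
  have move: "lmove k V \<in> S (Suc n)" if "V \<in> S n" for k V n
    using that
  proof (induction n arbitrary: V)
    case 0
    then show ?case using lmove_eq_lrefl[OF W] by (auto simp: S_0 S_Suc)
  next
    case (Suc n)
    then obtain i U where "V = (\<lambda>j. lrefl (W i) (U j))" "U \<in> S n" by (auto simp: S_Suc[of n])
    then show ?case
      unfolding S_Suc[of "Suc n"] using lmove_lrefl Suc.IH by blast
  qed
  have "\<exists>n. V \<in> S n"
    using assms(2) by induction (use S_0 move in blast)+
  then obtain n where "V \<in> S n" by blast
  then show ?thesis
  proof (induction n arbitrary: V)
    case 0
    then have "V = W" by (simp add: S_0)
    then show ?case using base[of W j] by blast
  next
    case (Suc n)
    then obtain i U where V: "V = (\<lambda>j. lrefl (W i) (U j))" "U \<in> S n" by (auto simp: S_Suc)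
    then obtain a x where x: "reduced_image W a x" "U j = x \<or> U j = - x"
      using Suc.IH by blast
    have Vj: "V j = lrefl (W i) x \<or> V j = - lrefl (W i) x" using x V by auto
    have ii: "lform (W i) (W i) = 1" using W by (simp add: lconf_def)
    show ?case
    proof (cases "a = i")
      case False
      then show ?thesis using x Vj step by blast
    next
      case True
      from x(1) show ?thesis
      proof cases
        case base
        then have "lrefl (W i) x = - x" using True ii
          by (simp add: lrefl_def scaleR_2)
        then have "V j = x \<or> V j = - x" using Vj by auto
        then show ?thesis using x(1) by blast
      next
        case (step b y)
        then have "lrefl (W i) x = y" using True lrefl_involution[OF ii] by simp
        then have "V j = y \<or> V j = - y" using Vj by simp
        then show ?thesis using step(2) by blast
      qed
    qed
  qed
qed

text \<open>The circle of \<open>V j\<close> lies in the closed disc of its first letter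
  \<open>b\<close>. If \<open>b \<noteq> i\<close>, a point of the circle \<open>W i\<close> can lie
  there only at the tangency point with \<open>W b\<close>. If the first letter is \<open>i\<close>,
  reflecting in \<open>W i\<close> fixes \<open>p\<close> and removes the letter.\<close>

lemma lorbit_intersection:
  assumes W: "lconf W" and V: "V \<in> lorbit W"
    and neq: "lpts (W i) \<noteq> lpts (V j)" and p: "p \<in> lpts (W i)" "p \<in> lpts (V j)"
  shows "\<exists>b. b \<noteq> i \<and> p = ltangent W i b"
proof -
  obtain e where e: "e = 1 \<or> e = - 1" "\<And>i j. i \<noteq> j \<Longrightarrow> snd (e *\<^sub>R (W i + W j)) > 0"
    using tangency_sign[OF W] by blast
  define n where "n = (p, 1::real)"
  have n: "lform n n = 0" "snd n > 0" "lform (W i) n = 0" "norm p = 1"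
    using p by (auto simp: n_def lpts_def lform_def norm_eq_1)
  have fin: ?thesis if "reduced_image W b y" "b \<noteq> i" "lform y n = 0" for b y
  proof -
    have "e * lform (W b) n \<ge> 0"
      using reduced_image_nested[OF W e(2) that(1,3)] n by blast
    moreover have "lform (e *\<^sub>R (W i + W b)) n \<le> 0"
      using e(2)[of i b] that(2) n tangency_null(1)[OF W, of i b]
      by (intro lform_null_le_0) (simp_all only: lform_scaleR_left lform_scaleR_right)
    ultimately have "lform (W b) n = 0" using n e(1) by auto
    then have "p \<in> lpts (W b)" using n by (simp add: lpts_def n_def)
    then show ?thesis using lpts_Int[OF W, of i b p] p that(2) by auto
  qed
  obtain a x where x: "reduced_image W a x" "V j = x \<or> V j = - x"
    using lorbit_reduced_image[OF W V] by blast
  have xn: "lform x n = 0" using x(2) p by (auto simp: n_def lpts_def)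
  show ?thesis
  proof (cases "a = i")
    case True
    from x(1) show ?thesis
    proof cases
      case base
      then have "lpts (V j) = lpts (W i)" using x(2) True by auto
      then show ?thesis using neq by simp
    next
      case (step b y)
      have "lrefl (W i) n = n" using n by (simp add: lrefl_def lform_commute)
      then have "lform y n = 0" using xn step True by (simp add: lform_lrefl_swap)
      then show ?thesis using fin step True by blast
    qed
  qed (use fin x xn in blast)
qed

subsection \<open>Density of the tangency points\<close>

text \<open>The hypotheses force \<open>p * q + q * r + r * p = 0\<close>. If no product with
  \<open>s\<close> were negative, the three terms, scaled by the square of \<open>s\<close>, would
  be nonnegative with sum 0, so two of the numbers vanish. In the descent, \<open>s\<close> is
  \<open>lform n (W k)\<close>.\<close>

lemma three_squares_eq_square_sum:
  fixes p q r s :: real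
  assumes s: "p + q + r = s" "p\<^sup>2 + q\<^sup>2 + r\<^sup>2 = s\<^sup>2"
  shows "p = 0 \<and> q = 0 \<or> p = 0 \<and> r = 0 \<or> q = 0 \<and> r = 0 \<or> p * s < 0 \<or> q * s < 0 \<or> r * s < 0"
proof (rule ccontr)
  assume "\<not> ?thesis"
  then have ge: "p * s \<ge> 0" "q * s \<ge> 0" "r * s \<ge> 0"
    and nz: "\<not> (p = 0 \<and> q = 0)" "\<not> (p = 0 \<and> r = 0)" "\<not> (q = 0 \<and> r = 0)" by auto
  have "s \<noteq> 0"
  proof
    assume "s = 0"
    then have "p\<^sup>2 + q\<^sup>2 + r\<^sup>2 = 0" using s by simp
    then have "p\<^sup>2 = 0" "q\<^sup>2 = 0"
      using zero_le_power2[of p] zero_le_power2[of q] zero_le_power2[of r] by linarith+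
    then show False using nz by simp
  qed
  have "p * q + q * r + r * p = 0"
    using s(2) unfolding s(1)[symmetric] by (simp add: power2_eq_square algebra_simps)
  then have "(p * q + q * r + r * p) * s\<^sup>2 = 0" by simp
  then have "(p * s) * (q * s) + (q * s) * (r * s) + (r * s) * (p * s) = 0"
    by (simp add: power2_eq_square algebra_simps)
  moreover have "(p * s) * (q * s) \<ge> 0" "(q * s) * (r * s) \<ge> 0" "(r * s) * (p * s) \<ge> 0"
    using ge by simp_all
  ultimately have "(p * s) * (q * s) = 0" "(q * s) * (r * s) = 0" "(r * s) * (p * s) = 0"
    by linarith+
  then show False using nz \<open>s \<noteq> 0\<close> by auto
qed

lemma abs_add_double_less:
  fixes p s :: real
  assumes "p * s < 0" "\<bar>p\<bar> < \<bar>s\<bar>"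
  shows "\<bar>s + 2 * p\<bar> < \<bar>s\<bar>"
  using assms by (auto simp: mult_less_0_iff)

lemma ex_index4:
  fixes k :: 4
  obtains a b c where "distinct [k, a, b, c]" "\<And>f :: 4 \<Rightarrow> real. sum f UNIV = f k + f a + f b + f c"
proof -
  consider "k = 1" | "k = 2" | "k = 3" | "k = 4" using exhaust_4 by blast
  then show ?thesis
  proof cases
    case 1 show ?thesis by (rule that[of 2 3 4]) (simp_all add: 1 sum_4)
  next
    case 2 show ?thesis by (rule that[of 1 3 4]) (simp_all add: 2 sum_4)
  next
    case 3 show ?thesis by (rule that[of 1 2 4]) (simp_all add: 3 sum_4)
  next
    case 4 show ?thesis by (rule that[of 1 2 3]) (simp_all add: 4 sum_4)
  qed
qed

lemma lform_ldual_right: "lform n (ldual W k) = (\<Sum>i\<in>UNIV. lform n (W i)) / 2 - lform n (W k)"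
  by (simp add: ldual_def lform_sum_right)

text \<open>The first equation is orthogonality to the dual vector;
  \<open>lconf_lform_square\<close> then gives the second. Removing the \<open>k\<close> term leaves
  the hypotheses of \<open>three_squares_eq_square_sum\<close>.\<close>

lemma null_on_ldual:
  assumes "lconf W" "lform n n = 0" "lform n (ldual W k) = 0"
  shows "(\<Sum>i\<in>UNIV. lform n (W i)) = 2 * lform n (W k)"
    "(\<Sum>i\<in>UNIV. (lform n (W i))\<^sup>2) = 2 * (lform n (W k))\<^sup>2"
proof -
  show *: "(\<Sum>i\<in>UNIV. lform n (W i)) = 2 * lform n (W k)"
    using assms(3) by (simp add: lform_ldual_right)
  show "(\<Sum>i\<in>UNIV. (lform n (W i))\<^sup>2) = 2 * (lform n (W k))\<^sup>2"
    using lconf_lform_square[OF assms(1), of n] assms(2) by (simp add: *)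
qed

definition tangencies :: "(4 \<Rightarrow> lvec) \<Rightarrow> (real^3) set" where
  "tangencies W = {ltangent V a b | V a b. V \<in> lorbit W \<and> a \<noteq> b}"

lemma lproj_eq_ltangent:
  assumes "lconf W" "a \<noteq> b" "lform n n = 0" "snd n \<noteq> 0" "lform n (W a) = 0" "lform n (W b) = 0"
  shows "lproj n = ltangent W a b"
  using assms lpts_Int[of W a b "lproj n"] lproj_in_lpts[of n]
  by (simp add: lform_commute)

text \<open>An infinite descent: inverting in a circle \<open>W a\<close> with \<open>lform n (W a)\<close> of sign opposite to
  \<open>lform n (W k)\<close> decreases \<open>\<bar>lform n (W k)\<bar>\<close>, and it preserves \<open>ldual W k\<close>.\<close>

lemma integral_point_tangency:
  assumes "lconf W" "lform n n = 0" "snd n \<noteq> 0" "lform n (ldual W k) = 0"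
    and "\<And>a. lform n (W a) \<in> \<int>"
  shows "lproj n \<in> tangencies W"
  using assms
proof (induction "nat \<lfloor>\<bar>lform n (W k)\<bar>\<rfloor>" arbitrary: W rule: less_induct)
  case less
  note W = less.prems(1)
  let ?f = "\<lambda>a. lform n (W a)"
  have descend: "lproj n \<in> tangencies W" if x: "?f x * ?f k < 0" "\<bar>?f x\<bar> < \<bar>?f k\<bar>" "x \<noteq> k" for x
  proof -
    let ?V = "lmove x W"
    have fk: "lform n (?V k) = ?f k + 2 * ?f x" using x(3) by (simp add: lmove_def)
    have ints: "\<And>a. lform n (?V a) \<in> \<int>" using less.prems(5) by (simp add: lmove_def)
    have "\<bar>lform n (?V k)\<bar> < \<bar>?f k\<bar>"
      unfolding fk by (rule abs_add_double_less[OF x(1,2)])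
    \<comment> \<open>Both products are integers, so the strict decrease survives the floor in the
      induction measure.\<close>
    moreover obtain i j where "lform n (?V k) = of_int i" "?f k = of_int j"
      using ints less.prems(5) by (metis Ints_cases)
    ultimately have "nat \<lfloor>\<bar>lform n (?V k)\<bar>\<rfloor> < nat \<lfloor>\<bar>?f k\<bar>\<rfloor>"
      by (simp flip: of_int_abs)
    moreover have "lform n (ldual ?V k) = 0"
      using x(3) less.prems(4) by (simp add: ldual_lmove_other)
    ultimately have "lproj n \<in> tangencies ?V"
      using less.hyps less.prems(2,3) lconf_lmove[OF W] ints by blast
    moreover have "?V \<in> lorbit W" by (intro lorbit.intros)
    ultimately show ?thesis unfolding tangencies_def using lorbit_trans by blast
  qed
  have stop: "lproj n \<in> tangencies W" if "?f a = 0" "?f b = 0" "a \<noteq> b" for a b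
    using lproj_eq_ltangent[OF W that(3) less.prems(2,3) that(1,2)] that(3) lorbit_refl
    unfolding tangencies_def by blast
  obtain a b c where abc: "distinct [k, a, b, c]"
    and sum: "\<And>f :: 4 \<Rightarrow> real. sum f UNIV = f k + f a + f b + f c"
    using ex_index4 by blast
  note eqs = null_on_ldual[OF W less.prems(2,4), unfolded sum]
  have lin: "?f a + ?f b + ?f c = ?f k" and sq: "(?f a)\<^sup>2 + (?f b)\<^sup>2 + (?f c)\<^sup>2 = (?f k)\<^sup>2"
    using eqs by linarith+
  \<comment> \<open>The descent needs a strict inequality. The sum of squares gives it unless the
    other two products vanish, and then the point is already a tangency point.\<close>
  have small: "lproj n \<in> tangencies W \<or> \<bar>x\<bar> < \<bar>?f k\<bar>"
    if "x\<^sup>2 + y\<^sup>2 + z\<^sup>2 = (?f k)\<^sup>2" "y = ?f u" "z = ?f v" "u \<noteq> v" for x y z u v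
  proof (cases "y = 0 \<and> z = 0")
    case False
    then have "y\<^sup>2 + z\<^sup>2 > 0" by (simp add: sum_power2_gt_zero_iff)
    then have "x\<^sup>2 < (?f k)\<^sup>2" using that by linarith
    then show ?thesis by (meson abs_le_square_iff not_le)
  next
    case True
    then show ?thesis using stop[of u v] that by simp
  qed
  have ne: "a \<noteq> b" "a \<noteq> c" "b \<noteq> c" "a \<noteq> k" "b \<noteq> k" "c \<noteq> k" using abc by auto
  from three_squares_eq_square_sum[OF lin sq] show ?case
  proof (elim disjE)
    assume "?f a * ?f k < 0"
    then show ?thesis using small[of "?f a" "?f b" "?f c" b c] sq descend[of a] ne by blast
  next
    assume "?f b * ?f k < 0"
    moreover have "(?f b)\<^sup>2 + (?f a)\<^sup>2 + (?f c)\<^sup>2 = (?f k)\<^sup>2" using sq by linarith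
    ultimately show ?thesis using small[of "?f b" "?f a" "?f c" a c] descend[of b] ne by blast
  next
    assume "?f c * ?f k < 0"
    moreover have "(?f c)\<^sup>2 + (?f a)\<^sup>2 + (?f b)\<^sup>2 = (?f k)\<^sup>2" using sq by linarith
    ultimately show ?thesis using small[of "?f c" "?f a" "?f b" a b] descend[of c] ne by blast
  qed (use stop ne in blast)+
qed

section \<open>Approximation by rational points\<close>

lemma common_denominator:
  fixes g :: "'a::finite \<Rightarrow> real"
  assumes "\<And>j. g j \<in> \<rat>"
  obtains d :: real where "d > 0" "\<And>j. d * g j \<in> \<int>"
proof -
  have "\<exists>d::nat. d > 0 \<and> of_nat d * g j \<in> \<int>" for j
  proof -
    obtain m n :: int where mn: "n > 0" "g j = of_int m / of_int n"
      using assms[of j] by (elim Rats_cases') auto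
    then have "of_nat (nat n) * g j = of_int m" by simp
    then show ?thesis using mn by (metis Ints_of_int zero_less_nat_eq)
  qed
  then obtain d :: "'a \<Rightarrow> nat" where d: "\<And>j. d j > 0" "\<And>j. of_nat (d j) * g j \<in> \<int>"
    by metis
  show ?thesis
  proof (rule that[of "\<Prod>j\<in>UNIV. of_nat (d j)"])
    show "(\<Prod>j\<in>UNIV. real (d j)) > 0" using d by (simp add: prod_pos)
    fix j
    have "(\<Prod>i\<in>UNIV. real (d i)) * g j = (\<Prod>i\<in>UNIV - {j}. real (d i)) * (d j * g j)"
      by (simp add: prod.remove[of UNIV j])
    also have "\<dots> = real (\<Prod>i\<in>UNIV - {j}. d i) * (d j * g j)" by simp
    also have "\<dots> \<in> \<int>" by (rule Ints_mult[OF Ints_of_nat d(2)])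
    finally show "(\<Prod>i\<in>UNIV. real (d i)) * g j \<in> \<int>" .
  qed
qed

lemma lproj_scaleR: "a \<noteq> 0 \<Longrightarrow> lproj (a *\<^sub>R n) = lproj n"
  by (simp add: lproj_def)

lemma rational_point_tangency:
  assumes "lconf W" "lform n n = 0" "snd n \<noteq> 0" "lform n (ldual W k) = 0"
    and "\<And>a. lform n (W a) \<in> \<rat>"
  shows "lproj n \<in> tangencies W"
proof -
  obtain d where d: "d > 0" "\<And>a. d * lform n (W a) \<in> \<int>"
    using common_denominator[of "\<lambda>a. lform n (W a)"] assms(5) by blast
  then have "lproj (d *\<^sub>R n) \<in> tangencies W"
    using assms by (intro integral_point_tangency[of _ _ k]) auto
  then show ?thesis using d by (simp add: lproj_scaleR)
qed

lemma rational_sequence: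
  obtains x :: "nat \<Rightarrow> real" where "\<And>n. x n \<in> \<rat>" "x \<longlonglongrightarrow> u"
  using Rats_closure_real closure_sequential[of u \<rat>] by auto

text \<open>Null directions on the dual circle have a rational parametrization: if \<open>u\<close>,
  \<open>v\<close> are the products with \<open>W a\<close>, \<open>W b\<close>, the quadratic
  relation gives \<open>- u * v / (u + v)\<close> for \<open>W c\<close>, and the product with
  \<open>W k\<close> is the sum of the three. Rational \<open>u\<close>, \<open>v\<close> near the
  given values yield tangency points near \<open>p\<close>.\<close>

lemma ldual_circle_subset_closure:
  assumes W: "lconf W"
  shows "lpts (ldual W k) \<subseteq> closure (tangencies W)"
proof
  fix p assume p: "p \<in> lpts (ldual W k)"
  define n where "n = (p, 1::real)"
  let ?f = "\<lambda>a. lform n (W a)"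
  have n: "lform n n = 0" "snd n = 1" "lform n (ldual W k) = 0" "lproj n = p"
    using p by (auto simp: n_def lpts_def lform_def norm_eq_1 lproj_def inner_commute)
  obtain a b c where abc: "distinct [k, a, b, c]"
    and sum: "\<And>f :: 4 \<Rightarrow> real. sum f UNIV = f k + f a + f b + f c"
    using ex_index4 by blast
  \<comment> \<open>The indicator of \<open>j\<close> has sum 1, so one of its four values is
    nonzero.\<close>
  have exh: "j = k \<or> j = a \<or> j = b \<or> j = c" for j
    using sum[of "\<lambda>i. if i = j then 1 else 0"] by (auto split: if_splits)
  note eqs = null_on_ldual[OF W n(1,3), unfolded sum]
  have lin: "?f k = ?f a + ?f b + ?f c" and sq: "(?f a)\<^sup>2 + (?f b)\<^sup>2 + (?f c)\<^sup>2 = (?f k)\<^sup>2"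
    using eqs by linarith+
  show "p \<in> closure (tangencies W)"
  proof (cases "?f a + ?f b = 0")
    \<comment> \<open>A zero denominator forces \<open>?f a = ?f b = 0\<close>, so \<open>p\<close>
      is itself a tangency point.\<close>
    case True
    then have "?f k = ?f c" using lin by simp
    then have "(?f a)\<^sup>2 + (?f b)\<^sup>2 = 0" using sq by simp
    then have "?f a = 0" "?f b = 0" by (simp_all add: sum_power2_eq_zero_iff)
    then have "lproj n = ltangent W a b"
      using lproj_eq_ltangent[OF W _ n(1)] n(2) abc by simp
    then have "p \<in> tangencies W"
      using abc n(4) lorbit_refl unfolding tangencies_def by auto
    then show ?thesis using closure_subset by blast
  next
    case False
    define g where "g u v = (\<lambda>i. if i = a then u else if i = b then v
      else if i = c then - u * v / (u + v) else u + v - u * v / (u + v))" for u v :: real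
    \<comment> \<open>The vector with products \<open>g u v\<close>, built with the inverse Gram
      matrix as in \<open>lconf_expand\<close>.\<close>
    define N where "N u v = (1 / 4) *\<^sub>R (\<Sum>i\<in>UNIV. (2 * g u v i - sum (g u v) UNIV) *\<^sub>R W i)"
      for u v
    have gs: "g u v a = u" "g u v b = v" "g u v c = - u * v / (u + v)"
      "g u v k = u + v - u * v / (u + v)" for u v
      using abc by (auto simp: g_def)
    have N: "lform (N u v) (W j) = g u v j" for u v j
      unfolding N_def
      by (simp add: lconf_lform_comb[OF W] sum_subtractf sum_distrib_left[symmetric])
    have "?f c * (?f a + ?f b) = - ?f a * ?f b"
      using sq unfolding lin by (simp add: power2_eq_square algebra_simps)
    then have fc: "?f c = - ?f a * ?f b / (?f a + ?f b)"
      using False by (simp add: field_simps)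
    have "N (?f a) (?f b) = n"
    proof (rule lconf_eqI[OF W])
      fix j
      show "lform (N (?f a) (?f b)) (W j) = ?f j"
        unfolding N using exh[of j] lin fc by (auto simp: gs)
    qed
    obtain x where x: "\<And>i. x i \<in> \<rat>" "x \<longlonglongrightarrow> ?f a" using rational_sequence by blast
    obtain y where y: "\<And>i. y i \<in> \<rat>" "y \<longlonglongrightarrow> ?f b" using rational_sequence by blast
    have xy: "(\<lambda>i. x i + y i) \<longlonglongrightarrow> ?f a + ?f b" by (intro tendsto_intros x y)
    have "(\<lambda>i. g (x i) (y i) j) \<longlonglongrightarrow> g (?f a) (?f b) j" for j
      using exh[of j] by (auto simp: gs intro!: tendsto_intros x y False)
    then have "(\<lambda>i. N (x i) (y i)) \<longlonglongrightarrow> N (?f a) (?f b)"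
      unfolding N_def by (intro tendsto_intros)
    then have lim: "(\<lambda>i. N (x i) (y i)) \<longlonglongrightarrow> n"
      using \<open>N (?f a) (?f b) = n\<close> by simp
    then have lim1: "(\<lambda>i. snd (N (x i) (y i))) \<longlonglongrightarrow> 1"
      using n(2) tendsto_snd by fastforce
    have limp: "(\<lambda>i. lproj (N (x i) (y i))) \<longlonglongrightarrow> p"
      unfolding n(4)[symmetric] lproj_def
      by (intro tendsto_intros lim) (simp add: n)
    have ev: "\<forall>\<^sub>F i in sequentially. lproj (N (x i) (y i)) \<in> tangencies W"
      using order_tendstoD(1)[OF lim1, of 0, simplified] tendsto_imp_eventually_ne[OF xy False]
    proof eventually_elim
      case (elim i)
      let ?n = "N (x i) (y i)"
      show ?case
      proof (rule rational_point_tangency[OF W, of _ k])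
        define t where "t = x i * y i / (x i + y i)"
        have t: "- x i * y i / (x i + y i) = - t" "t * (x i + y i) = x i * y i"
          using elim(2) by (simp_all add: t_def)
        have "4 * lform ?n ?n = 4 * (t * (x i + y i) - x i * y i)"
          unfolding lconf_lform_square[OF W] N sum gs t(1) t_def[symmetric]
          by (simp add: power2_eq_square algebra_simps)
        also have "\<dots> = 0" by (simp add: t(2))
        finally have "4 * lform ?n ?n = 0" .
        then show "lform ?n ?n = 0" by simp
        show "lform ?n (ldual W k) = 0"
          unfolding lform_ldual_right N sum gs by simp
        show "lform ?n (W j) \<in> \<rat>" for j
          unfolding N g_def using x y by (auto intro!: Rats_add Rats_diff Rats_divide Rats_mult)
      qed (use elim in simp)
    qed
    show ?thesis
      by (rule Lim_in_closed_set[OF closed_closure _ _ limp])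
        (use ev closure_subset in \<open>auto elim!: eventually_mono\<close>)
  qed
qed

text \<open>Both sides are the closure of \<open>tangencies W\<close>: ping-pong identifies this set
  with the intersection points, and it is contained and dense in the union of the dual
  circles.\<close>

lemma closure_intersections_eq:
  assumes W: "lconf W"
  shows "closure {p. \<exists>U\<in>lorbit W. \<exists>V\<in>lorbit W. \<exists>i j.
      lpts (U i) \<noteq> lpts (V j) \<and> p \<in> lpts (U i) \<and> p \<in> lpts (V j)}
    = closure (\<Union>V\<in>lorbit W. \<Union>k. lpts (ldual V k))" (is "closure ?S = closure ?L")
proof -
  have "?S = tangencies W"
  proof
    show "?S \<subseteq> tangencies W"
    proof clarify
      fix p U V i j
      assume U: "U \<in> lorbit W" and V: "V \<in> lorbit W"
        and p: "lpts (U i) \<noteq> lpts (V j)" "p \<in> lpts (U i)" "p \<in> lpts (V j)"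
      have "V \<in> lorbit U" using lorbit_trans[OF V lorbit_sym[OF U]] .
      then show "p \<in> tangencies W"
        using lorbit_intersection[OF lconf_lorbit[OF U W], of V i j p] p U
        unfolding tangencies_def by blast
    qed
    show "tangencies W \<subseteq> ?S"
    proof
      fix p assume "p \<in> tangencies W"
      then obtain V a b where V: "V \<in> lorbit W" and ab: "a \<noteq> b" and p: "p = ltangent V a b"
        unfolding tangencies_def by blast
      have "p \<in> lpts (V a) \<and> p \<in> lpts (V b)" "lpts (V a) \<noteq> lpts (V b)"
        using lpts_Int[OF lconf_lorbit[OF V W] ab] lpts_neq[OF lconf_lorbit[OF V W] ab] p by simp_all
      then show "p \<in> ?S" using V by blast
    qed
  qed
  moreover have "tangencies W \<subseteq> ?L"
  proof
    fix p assume "p \<in> tangencies W"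
    then obtain V a b where "V \<in> lorbit W" "a \<noteq> b" "p = ltangent V a b"
      unfolding tangencies_def by blast
    moreover obtain k where "k \<noteq> a" "k \<noteq> b" using ex_other by blast
    ultimately have "p \<in> lpts (ldual V k)" "V \<in> lorbit W"
      using ltangent_in_ldual[OF lconf_lorbit[OF _ W]] by auto
    then show "p \<in> ?L" by blast
  qed
  moreover have "?L \<subseteq> closure (tangencies W)"
  proof clarify
    fix V k p assume V: "V \<in> lorbit W" and p: "p \<in> lpts (ldual V k)"
    have "tangencies V \<subseteq> tangencies W"
      unfolding tangencies_def using lorbit_trans[OF _ V] by blast
    then show "p \<in> closure (tangencies W)"
      using p ldual_circle_subset_closure[OF lconf_lorbit[OF V W]] closure_mono by blast
  qed
  ultimately show ?thesis
    using closure_mono[of "tangencies W" ?L] closure_minimal[of ?L "closure (tangencies W)"] by auto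
qed

subsection \<open>Oriented circles as Lorentz vectors\<close>

text \<open>A linear change of the augmented curvature-center coordinates, chosen so that a point \<open>p\<close> of
  the unit sphere lies on \<open>C\<close> iff \<open>lform (oc_vec C) (p, 1) = 0\<close>, and in its interior iff this
  is positive.\<close>

definition lorentz :: "real^4 \<Rightarrow> lvec" where
  "lorentz w = (vector [w $ 3, w $ 4, (w $ 1 - w $ 2) / 2], (w $ 1 + w $ 2) / 2)"

lemma lorentz_add: "lorentz (x + y) = lorentz x + lorentz y"
  and lorentz_scaleR: "lorentz (a *\<^sub>R x) = a *\<^sub>R lorentz x"
  by (simp_all add: lorentz_def prod_eq_iff vec_eq_iff forall_3 field_simps)

lemma lorentz_sum: "lorentz (sum f A) = (\<Sum>i\<in>A. lorentz (f i))"
proof (induction A rule: infinite_finite_induct)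
qed (use lorentz_scaleR[of 0] in \<open>simp_all add: lorentz_add\<close>)

lemma lorentz_eq_iff: "lorentz x = lorentz y \<longleftrightarrow> x = y"
  by (auto simp: lorentz_def prod_eq_iff vec_eq_iff forall_3 forall_4)

lemma lorentz_surj: "\<exists>w. lorentz w = x"
proof
  show "lorentz (\<chi> j. if j = 1 then snd x + fst x $ 3 else if j = 2 then snd x - fst x $ 3
      else if j = 3 then fst x $ 1 else fst x $ 2) = x"
    by (simp add: lorentz_def prod_eq_iff vec_eq_iff forall_3)
qed

text \<open>This is twice the form given by the inverse of \<open>Q\<^sub>W\<close>, which is why
  Descartes configurations have Gram matrix \<open>2 Q\<^sub>D\<close>.\<close>

lemma lform_lorentz:
  "lform (lorentz v) (lorentz w) = v $ 3 * w $ 3 + v $ 4 * w $ 4 - (v $ 1 * w $ 2 + v $ 2 * w $ 1) / 2"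
  by (simp add: lform_def lorentz_def inner_vec_def sum_3 field_simps)

lemma lform_lorentz_self: "lform (lorentz w) (lorentz w) = (w $ 3)\<^sup>2 + (w $ 4)\<^sup>2 - w $ 1 * w $ 2"
  by (simp add: lform_lorentz power2_eq_square)

definition oc_vec :: "ocircle \<Rightarrow> lvec" where
  "oc_vec C = lorentz (wvec C)"

lemma oc_vec_reverse: "oc_vec (reverse_oc C) = - oc_vec C"
  by (cases C) (auto simp: oc_vec_def lorentz_def prod_eq_iff vec_eq_iff forall_3 field_simps)

lemma valid_oc_reverse [simp]: "valid_oc (reverse_oc C) = valid_oc C"
  by (cases C) auto

lemma lform_oc_vec:
  assumes "valid_oc C"
  shows "lform (oc_vec C) (oc_vec C) = 1"
proof (cases C)
  case (OCirc c r)
  then have "(Re c / r)\<^sup>2 + (Im c / r)\<^sup>2 - ((cmod c)\<^sup>2 - r\<^sup>2) / r * (1 / r) = 1"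
    unfolding cmod_power2 using assms by (simp add: field_simps power2_eq_square)
  then show ?thesis
    using OCirc by (simp add: oc_vec_def lform_lorentz_self)
next
  case (OLine h m)
  then show ?thesis
    using assms cmod_power2[of h] by (simp add: oc_vec_def lform_lorentz_self)
qed

text \<open>Coordinate 2 of \<open>w\<close> is the curvature. If it is zero, the unit condition
  makes \<open>(w $ 3, w $ 4)\<close> a unit normal; otherwise radius and centre are quotients by
  it, and the unit condition recovers coordinate 1.\<close>

lemma oc_vec_surj:
  assumes "lform x x = 1"
  shows "\<exists>C. valid_oc C \<and> oc_vec C = x"
proof -
  obtain w where w: "lorentz w = x" using lorentz_surj by blast
  have q: "(w $ 3)\<^sup>2 + (w $ 4)\<^sup>2 - w $ 1 * w $ 2 = 1"
    using assms unfolding w[symmetric] lform_lorentz_self .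
  show ?thesis
  proof (cases "w $ 2 = 0")
    case True
    then have "wvec (OLine (Complex (w $ 3) (w $ 4)) (w $ 1 / 2)) = w"
      by (simp add: vec_eq_iff forall_4)
    moreover have "valid_oc (OLine (Complex (w $ 3) (w $ 4)) (w $ 1 / 2))"
      using q True by (simp add: cmod_def)
    ultimately show ?thesis using w oc_vec_def by metis
  next
    case False
    let ?C = "OCirc (Complex (w $ 3 / w $ 2) (w $ 4 / w $ 2)) (1 / w $ 2)"
    have q': "(w $ 3)\<^sup>2 + (w $ 4)\<^sup>2 - 1 = w $ 1 * w $ 2" using q by simp
    have "((w $ 3 / w $ 2)\<^sup>2 + (w $ 4 / w $ 2)\<^sup>2 - (1 / w $ 2)\<^sup>2) / (1 / w $ 2)
        = ((w $ 3)\<^sup>2 + (w $ 4)\<^sup>2 - 1) / w $ 2"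
      using False by (simp add: field_simps power2_eq_square)
    also have "\<dots> = w $ 1" unfolding q' using False by simp
    finally have "wvec ?C = w"
      using False by (simp add: vec_eq_iff forall_4 cmod_power2)
    moreover have "valid_oc ?C" using False by simp
    ultimately show ?thesis using w oc_vec_def by metis
  qed
qed

section \<open>Stereographic projection and incidence\<close>

lemma norm_stereo [simp]: "norm (stereo z) = 1"
proof -
  define d where "d = (cmod z)\<^sup>2 + 1"
  have d: "d > 0" by (simp add: d_def add_nonneg_pos)
  have "(2 * Re z)\<^sup>2 + (2 * Im z)\<^sup>2 + (d - 2)\<^sup>2 = d\<^sup>2"
    unfolding d_def cmod_power2 by (simp add: power2_eq_square algebra_simps)
  then have "(2 * Re z / d)\<^sup>2 + (2 * Im z / d)\<^sup>2 + ((d - 2) / d)\<^sup>2 = 1"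
    using d by (simp add: power_divide add_divide_distrib[symmetric])
  then show ?thesis
    by (simp add: norm_eq_1 inner_vec_def sum_3 stereo_def d_def power2_eq_square)
qed

lemma stereo_surj:
  assumes "norm p = 1" "p \<noteq> npole"
  shows "p \<in> range stereo"
proof -
  have s: "(p $ 1)\<^sup>2 + (p $ 2)\<^sup>2 + (p $ 3)\<^sup>2 = 1"
    using assms(1) by (simp add: norm_eq_1 inner_vec_def sum_3 power2_eq_square)
  have ne: "p $ 3 \<noteq> 1"
  proof
    assume "p $ 3 = 1"
    then have "(p $ 1)\<^sup>2 + (p $ 2)\<^sup>2 = 0" using s by simp
    then have "p $ 1 = 0" "p $ 2 = 0" by (simp_all add: sum_power2_eq_zero_iff)
    then show False using assms(2) \<open>p $ 3 = 1\<close> by (simp add: npole_def vec_eq_iff forall_3)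
  qed
  \<comment> \<open>Stereographic projection of \<open>p\<close> from the north pole.\<close>
  define z where "z = Complex (p $ 1 / (1 - p $ 3)) (p $ 2 / (1 - p $ 3))"
  have "(cmod z)\<^sup>2 = ((p $ 1)\<^sup>2 + (p $ 2)\<^sup>2) / (1 - p $ 3)\<^sup>2"
    by (simp add: z_def cmod_power2 power_divide add_divide_distrib)
  also have "(p $ 1)\<^sup>2 + (p $ 2)\<^sup>2 = (1 - p $ 3) * (1 + p $ 3)"
    using s by (simp add: power2_eq_square algebra_simps)
  finally have z: "(cmod z)\<^sup>2 = (1 + p $ 3) / (1 - p $ 3)"
    using ne by (simp add: power2_eq_square)
  have z1: "(cmod z)\<^sup>2 + 1 = 2 / (1 - p $ 3)" unfolding z using ne by (simp add: field_simps)
  have z2: "(cmod z)\<^sup>2 - 1 = 2 * p $ 3 / (1 - p $ 3)" unfolding z using ne by (simp add: field_simps)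
  have "p = stereo z"
    unfolding stereo_def z1 z2 using ne
    by (simp add: vec_eq_iff forall_3) (simp add: z_def)
  then show ?thesis by blast
qed

lemma norm_npole [simp]: "norm npole = 1"
  by (simp add: norm_eq_1 inner_vec_def sum_3 npole_def)

lemma sphere_Collect:
  "{p. norm p = 1 \<and> Q p} = stereo ` {z. Q (stereo z)} \<union> (if Q npole then {npole} else {})"
    (is "?L = ?R")
proof
  show "?L \<subseteq> ?R"
  proof
    fix p assume p: "p \<in> ?L"
    show "p \<in> ?R"
    proof (cases "p = npole")
      case False
      then obtain z where "p = stereo z" using p stereo_surj by blast
      then show ?thesis using p by blast
    qed (use p in simp)
  qed
  show "?R \<subseteq> ?L" by auto
qed

lemma lform_npole: "lform (lorentz w) (npole, 1) = - w $ 2"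
  by (simp add: lform_def lorentz_def npole_def inner_vec_def sum_3 field_simps)

lemma lform_stereo:
  "lform (lorentz w) (stereo z, 1)
    = (2 * (w $ 3 * Re z + w $ 4 * Im z) - w $ 1 - w $ 2 * (cmod z)\<^sup>2) / ((cmod z)\<^sup>2 + 1)"
proof -
  define d where "d = (cmod z)\<^sup>2 + 1"
  have d: "d > 0" by (simp add: d_def add_nonneg_pos)
  have z: "(cmod z)\<^sup>2 = d - 1" by (simp add: d_def)
  show ?thesis
    unfolding lform_def lorentz_def stereo_def z
    using d by (simp add: inner_vec_def sum_3 field_simps)
qed

text \<open>The numerator is minus the power of \<open>z\<close> with respect to the circle;
  dividing by the signed \<open>r\<close> accounts for the orientation.\<close>

lemma lform_circle_stereo:
  assumes "r \<noteq> 0"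
  shows "lform (oc_vec (OCirc c r)) (stereo z, 1) = (r\<^sup>2 - (cmod (z - c))\<^sup>2) / (r * ((cmod z)\<^sup>2 + 1))"
proof -
  have "(2 * (Re c / r * Re z + Im c / r * Im z) - ((cmod c)\<^sup>2 - r\<^sup>2) / r - 1 / r * (cmod z)\<^sup>2)
      = (r\<^sup>2 - (cmod (z - c))\<^sup>2) / r"
    unfolding cmod_power2 using assms by (simp add: field_simps power2_eq_square)
  then show ?thesis
    by (simp add: oc_vec_def lform_stereo)
qed

lemma lform_line_stereo:
  "lform (oc_vec (OLine h m)) (stereo z, 1) = 2 * (Re z * Re h + Im z * Im h - m) / ((cmod z)\<^sup>2 + 1)"
  by (simp add: oc_vec_def lform_stereo mult.commute)

lemma pts_eq_lpts:
  assumes "valid_oc C"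
  shows "pts C = lpts (oc_vec C)"
proof (cases C)
  case (OCirc c r)
  then have r: "r \<noteq> 0" using assms by simp
  have "(cmod z)\<^sup>2 + 1 > 0" for z by (simp add: add_nonneg_pos)
  then have "lform (oc_vec C) (stereo z, 1) = 0 \<longleftrightarrow> cmod (z - c) = \<bar>r\<bar>" for z
    using r abs_le_square_iff[of r "cmod (z - c)"] abs_le_square_iff[of "cmod (z - c)" r]
    unfolding OCirc lform_circle_stereo[OF r] by (auto simp: less_le add_nonneg_eq_0_iff)
  then show ?thesis
    unfolding lpts_def sphere_Collect using r
    by (simp add: OCirc oc_vec_def lform_npole)
next
  case (OLine h m)
  have "2 * x / ((cmod z)\<^sup>2 + 1) = 0 \<longleftrightarrow> x = 0" for x z
    using add_nonneg_pos[of "(cmod z)\<^sup>2" 1] by auto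
  then show ?thesis
    unfolding lpts_def sphere_Collect OLine lform_line_stereo
    by (simp only: pts.simps) (simp add: oc_vec_def lform_npole)
qed

lemma int_pts_eq:
  assumes "valid_oc C"
  shows "int_pts C = {p. norm p = 1 \<and> lform (oc_vec C) (p, 1) > 0}"
proof (cases C)
  case (OCirc c r)
  then have r: "r \<noteq> 0" using assms by simp
  have d: "(cmod z)\<^sup>2 + 1 > 0" for z by (simp add: add_nonneg_pos)
  have "lform (oc_vec C) (stereo z, 1) > 0 \<longleftrightarrow> (if r > 0 then cmod (z - c) < r else cmod (z - c) > - r)"
    for z
  proof -
    have "lform (oc_vec C) (stereo z, 1) > 0 \<longleftrightarrow> (r\<^sup>2 - (cmod (z - c))\<^sup>2) / r > 0"
      unfolding OCirc lform_circle_stereo[OF r] divide_divide_eq_left[symmetric]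
      by (simp only: pos_less_divide_eq[OF d[of z]] mult_zero_left)
    also have "\<dots> \<longleftrightarrow> (if r > 0 then (cmod (z - c))\<^sup>2 < r\<^sup>2 else r\<^sup>2 < (cmod (z - c))\<^sup>2)"
      using r by (simp add: zero_less_divide_iff)
    also have "(cmod (z - c))\<^sup>2 < r\<^sup>2 \<longleftrightarrow> cmod (z - c) < \<bar>r\<bar>"
      using abs_le_square_iff[of r "cmod (z - c)"] by (simp flip: not_le)
    also have "r\<^sup>2 < (cmod (z - c))\<^sup>2 \<longleftrightarrow> \<bar>r\<bar> < cmod (z - c)"
      using abs_le_square_iff[of "cmod (z - c)" r] by (simp flip: not_le)
    finally show ?thesis using r by (simp split: if_splits)
  qed
  moreover have "lform (oc_vec C) (npole, 1) > 0 \<longleftrightarrow> \<not> r > 0"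
    using r by (auto simp: OCirc oc_vec_def lform_npole)
  ultimately show ?thesis
    unfolding sphere_Collect by (simp add: OCirc)
next
  case (OLine h m)
  have "2 * x / ((cmod z)\<^sup>2 + 1) > 0 \<longleftrightarrow> x > 0" for x z
    using add_nonneg_pos[of "(cmod z)\<^sup>2" 1] by (simp add: zero_less_divide_iff)
  then show ?thesis
    unfolding sphere_Collect OLine lform_line_stereo
    by (simp only: int_pts.simps) (simp add: oc_vec_def lform_npole)
qed

text \<open>Near a common point the two caps are half-planes of the tangent plane whose unit normals
  have inner product \<open>lform w v\<close>; they are disjoint only if the normals are opposite.\<close>

lemma disjoint_caps_lform:
  assumes w: "lform w w = 1" and v: "lform v v = 1"
    and p: "p \<in> lpts w" "p \<in> lpts v"
    and disj: "{p. norm p = 1 \<and> lform w (p, 1) > 0} \<inter> {p. norm p = 1 \<and> lform v (p, 1) > 0} = {}"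
  shows "lform w v = - 1"
proof -
  \<comment> \<open>\<open>a\<close> and \<open>b\<close> are the components of \<open>fst w\<close>
    and \<open>fst v\<close> tangent to the sphere at \<open>p\<close>: the unit normals, with inner
    product \<open>B\<close>.\<close>
  define a where "a = fst w - snd w *\<^sub>R p"
  define b where "b = fst v - snd v *\<^sub>R p"
  define B where "B = lform w v"
  have pp: "p \<bullet> p = 1" "fst w \<bullet> p = snd w" "fst v \<bullet> p = snd v"
    using p by (auto simp: lpts_def lform_def norm_eq_1)
  then have pp': "p \<bullet> fst w = snd w" "p \<bullet> fst v = snd v" by (simp_all add: inner_commute)
  have wv: "fst w \<bullet> fst w = 1 + snd w * snd w" "fst v \<bullet> fst v = 1 + snd v * snd v"
    "fst w \<bullet> fst v = B + snd w * snd v" "fst v \<bullet> fst w = B + snd w * snd v"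
    using w v by (simp_all add: lform_def B_def inner_commute)
  have ab: "a \<bullet> a = 1" "b \<bullet> b = 1" "a \<bullet> b = B" "b \<bullet> a = B" "p \<bullet> a = 0" "p \<bullet> b = 0"
    "fst w \<bullet> a = 1" "fst w \<bullet> b = B" "fst v \<bullet> b = 1" "fst v \<bullet> a = B"
    using pp pp' wv by (simp_all add: a_def b_def inner_diff_left inner_diff_right)
  have "(a + b) \<bullet> (a + b) = 2 + 2 * B" using ab by (simp add: inner_add_left inner_add_right)
  then have ge: "B \<ge> - 1" using inner_ge_zero[of "a + b"] by linarith
  moreover have False if "B > - 1"
  proof -
    \<comment> \<open>A step small enough that \<open>2 * \<bar>snd u\<bar> * t < 1\<close> for
      \<open>u\<close> equal to \<open>w\<close> or \<open>v\<close>.\<close>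
    define t where "t = 1 / (2 * (\<bar>snd w\<bar> + \<bar>snd v\<bar> + 1))"
    have t: "t > 0" by (simp add: t_def add_nonneg_pos)
    define d where "d = 1 + (2 + 2 * B) * t\<^sup>2"
    have d: "d > 0" using that by (simp add: d_def add_pos_nonneg)
    have d1: "(2 + 2 * B) * t\<^sup>2 = d - 1" by (simp add: d_def)
    define c where "c = a + b"
    have c: "c \<bullet> c = 2 + 2 * B" "p \<bullet> c = 0" "c \<bullet> p = 0"
      using ab by (simp_all add: c_def inner_add_left inner_add_right inner_commute[of _ p])
    \<comment> \<open>\<open>q\<close> is a point near \<open>p\<close> in the direction
      \<open>c\<close>: the inverse stereographic image of \<open>t *\<^sub>R c\<close>, projecting
      from the antipode of \<open>p\<close>. The denominator \<open>d\<close> is one plus the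
      squared length of \<open>t *\<^sub>R c\<close>.\<close>
    define y where "y = (2 - d) *\<^sub>R p + (2 * t) *\<^sub>R c"
    define q where "q = (1 / d) *\<^sub>R y"
    have "y \<bullet> y = (2 - d)\<^sup>2 + 4 * ((2 + 2 * B) * t\<^sup>2)"
      using c pp(1) by (simp add: y_def inner_add_left inner_add_right power2_eq_square)
    also have "\<dots> = d\<^sup>2" unfolding d1 by (simp add: power2_eq_square algebra_simps)
    finally have "norm y = d" using d by (simp add: norm_eq_sqrt_inner)
    then have q: "norm q = 1" using d by (simp add: q_def)
    have pos: "lform u (q, 1) > 0"
      if u: "fst u \<bullet> p = snd u" "fst u \<bullet> a + fst u \<bullet> b = 1 + B" "\<bar>snd u\<bar> \<le> \<bar>snd w\<bar> + \<bar>snd v\<bar>" for u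
    proof -
      have uc: "fst u \<bullet> c = 1 + B" using u(2) by (simp add: c_def inner_add_right)
      have "(\<bar>snd w\<bar> + \<bar>snd v\<bar> + 1 - \<bar>snd u\<bar>) * t > 0" using u(3) t by simp
      moreover have "2 * (\<bar>snd w\<bar> + \<bar>snd v\<bar> + 1) * t = 1"
        using abs_ge_zero[of "snd w"] abs_ge_zero[of "snd v"] unfolding t_def by (simp add: field_simps)
      ultimately have "2 * \<bar>snd u\<bar> * t < 1" by (simp add: algebra_simps)
      moreover have "snd u * t \<le> \<bar>snd u\<bar> * t" using t by (intro mult_right_mono) auto
      ultimately have "2 * snd u * t < 1" by linarith
      then have "0 < 2 * t * (1 + B) * (1 - 2 * snd u * t)"
        using t \<open>B > - 1\<close> by (intro mult_pos_pos) auto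
      also have "\<dots> = 2 * t * (1 + B) - 2 * snd u * ((2 + 2 * B) * t\<^sup>2)"
        by (simp add: power2_eq_square algebra_simps)
      also have "\<dots> = fst u \<bullet> y - snd u * d"
        unfolding d1 y_def using u(1) uc by (simp add: inner_add_right algebra_simps)
      finally have "(fst u \<bullet> y - snd u * d) / d > 0" using d by simp
      then show ?thesis
        using d by (simp add: lform_def q_def diff_divide_distrib)
    qed
    have "lform w (q, 1) > 0" "lform v (q, 1) > 0"
      using ab pp by (auto intro!: pos)
    then show False using disj q by blast
  qed
  ultimately show ?thesis unfolding B_def by force
qed

section \<open>Circle configurations as vector configurations\<close>

definition oc_vecs :: "ocircle^4 \<Rightarrow> 4 \<Rightarrow> lvec" where
  "oc_vecs D = (\<lambda>i. oc_vec (D $ i))"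

lemma descartes_valid: "descartes D \<Longrightarrow> valid_oc (D $ i)"
  by (simp add: descartes_def)

lemma pts_descartes: "descartes D \<Longrightarrow> pts (D $ i) = lpts (oc_vecs D i)"
  by (simp add: pts_eq_lpts descartes_valid oc_vecs_def)

lemma lconf_oc_vecs:
  assumes D: "descartes D"
  shows "lconf (oc_vecs D)"
proof -
  have "lform (oc_vec (D $ i)) (oc_vec (D $ j)) = - 1" if ij: "i \<noteq> j" for i j
  proof -
    have val: "valid_oc (D $ i)" "valid_oc (D $ j)" using D by (auto simp: descartes_def)
    note units = val[THEN lform_oc_vec]
    have "tangent_oc (D $ i) (D $ j)" using D ij by (auto simp: descartes_def)
    then obtain p where "p \<in> pts (D $ i)" "p \<in> pts (D $ j)" unfolding tangent_oc_def by blast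
    then have p: "p \<in> lpts (oc_vec (D $ i))" "p \<in> lpts (oc_vec (D $ j))"
      using val by (simp_all add: pts_eq_lpts)
    have "int_pts (D $ i) \<inter> int_pts (D $ j) = {} \<or>
      int_pts (reverse_oc (D $ i)) \<inter> int_pts (reverse_oc (D $ j)) = {}"
      using D ij unfolding descartes_def by blast
    then show ?thesis
    proof
      assume "int_pts (D $ i) \<inter> int_pts (D $ j) = {}"
      then show ?thesis using disjoint_caps_lform[OF units p] val by (simp add: int_pts_eq)
    next
      assume "int_pts (reverse_oc (D $ i)) \<inter> int_pts (reverse_oc (D $ j)) = {}"
      then show ?thesis
        using disjoint_caps_lform[of "- oc_vec (D $ i)" "- oc_vec (D $ j)" p] units p val
        by (simp add: int_pts_eq oc_vec_reverse)
    qed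
  qed
  then show ?thesis
    using lform_oc_vec descartes_valid[OF D] by (simp add: lconf_def oc_vecs_def)
qed

text \<open>A point \<open>p\<close> in both caps would give two null vectors of the future cone,
  \<open>e *\<^sub>R (W i + W j)\<close> and \<open>(p, 1)\<close>, with positive product.\<close>

lemma disjoint_caps:
  assumes "lconf W" "i \<noteq> j" "snd (e *\<^sub>R (W i + W j)) > 0"
  shows "{p. norm p = 1 \<and> lform (e *\<^sub>R W i) (p, 1) > 0}
    \<inter> {p. norm p = 1 \<and> lform (e *\<^sub>R W j) (p, 1) > 0} = {}"
proof -
  have False if "norm p = 1" "lform (e *\<^sub>R W i) (p, 1) > 0" "lform (e *\<^sub>R W j) (p, 1) > 0" for p
  proof -
    have "lform (e *\<^sub>R (W i + W j)) (p, 1) \<le> 0"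
      using tangency_null(1)[OF assms(1,2)] assms(3) that(1)
      by (intro lform_null_le_0)
        (simp_all only: lform_scaleR_left lform_scaleR_right, simp_all add: lform_def norm_eq_1)
    then show False using that by (simp add: algebra_simps)
  qed
  then show ?thesis by blast
qed

lemma descartesI:
  assumes val: "\<And>i. valid_oc (D $ i)" and W: "lconf (oc_vecs D)"
  shows "descartes D"
proof -
  have pts: "pts (D $ i) = lpts (oc_vecs D i)" for i
    by (simp add: pts_eq_lpts val oc_vecs_def)
  note Int = lpts_Int[OF W]
  have tan: "tangent_oc (D $ i) (D $ j)" if "i \<noteq> j" for i j
    unfolding tangent_oc_def pts by (simp add: Int[OF that])
  have tp: "tpoint (D $ i) (D $ j) = ltangent (oc_vecs D) i j" if "i \<noteq> j" for i j
    unfolding tpoint_def pts by (simp add: Int[OF that])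
  have ne: "tpoint (D $ i) (D $ j) \<noteq> tpoint (D $ k) (D $ l)"
    if ij: "i \<noteq> j" and kl: "k \<noteq> l" and ijkl: "{i, j} \<noteq> {k, l}" for i j k l
  proof
    assume "tpoint (D $ i) (D $ j) = tpoint (D $ k) (D $ l)"
    then have eq: "ltangent (oc_vecs D) i j = ltangent (oc_vecs D) k l" by (simp add: tp ij kl)
    \<comment> \<open>Some circle of the second pair is outside the first pair; it would pass
      through the tangency point of the first.\<close>
    have "\<exists>x. (x = k \<or> x = l) \<and> x \<noteq> i \<and> x \<noteq> j"
    proof (rule ccontr)
      assume "\<not> ?thesis"
      then have "k = i \<or> k = j" "l = i \<or> l = j" by auto
      then show False using kl ijkl by auto
    qed
    then obtain x where x: "x = k \<or> x = l" "x \<noteq> i" "x \<noteq> j" by blast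
    have "ltangent (oc_vecs D) k l \<in> lpts (oc_vecs D x)"
      using Int[OF kl] x(1) by blast
    then show False using ltangent_notin[OF W ij x(2,3)] eq by simp
  qed
  \<comment> \<open>The sign \<open>e\<close> selects the alternative in \<open>descartes\<close>:
    interiors disjoint as given, or after reversal.\<close>
  obtain e :: real where e: "e = 1 \<or> e = - 1"
    and pos: "\<And>i j. i \<noteq> j \<Longrightarrow> snd (e *\<^sub>R (oc_vecs D i + oc_vecs D j)) > 0"
    using tangency_sign[OF W] by blast
  note caps = disjoint_caps[OF W _ pos]
  have "(\<forall>i j. i \<noteq> j \<longrightarrow> int_pts (D $ i) \<inter> int_pts (D $ j) = {}) \<or>
      (\<forall>i j. i \<noteq> j \<longrightarrow> int_pts (reverse_oc (D $ i)) \<inter> int_pts (reverse_oc (D $ j)) = {})"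
    using e
  proof
    assume "e = 1"
    then have "int_pts (D $ i) \<inter> int_pts (D $ j) = {}" if "i \<noteq> j" for i j
      using caps[OF that that] by (simp add: int_pts_eq val oc_vecs_def)
    then show ?thesis by blast
  next
    assume "e = - 1"
    then have "int_pts (reverse_oc (D $ i)) \<inter> int_pts (reverse_oc (D $ j)) = {}"
      if "i \<noteq> j" for i j
      using caps[OF that that] by (simp add: int_pts_eq val oc_vecs_def oc_vec_reverse)
    then show ?thesis by blast
  qed
  then show ?thesis
    unfolding descartes_def by (intro conjI allI impI val tan ne)
qed

lemma descartes_realize:
  assumes "lconf W"
  shows "\<exists>D. descartes D \<and> oc_vecs D = W"
proof -
  have "\<forall>i. \<exists>C. valid_oc C \<and> oc_vec C = W i"
    using oc_vec_surj lconf_same[OF assms] by blast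
  then obtain C where C: "\<And>i. valid_oc (C i)" "\<And>i. oc_vec (C i) = W i" by metis
  have W: "oc_vecs (\<chi> i. C i) = W" using C by (simp add: oc_vecs_def)
  then have "descartes (\<chi> i. C i)"
    using C(1) assms by (intro descartesI) simp_all
  then show ?thesis using W by blast
qed

section \<open>The action of the matrix group on rows\<close>

definition lact :: "real^4^4 \<Rightarrow> (4 \<Rightarrow> lvec) \<Rightarrow> 4 \<Rightarrow> lvec" where
  "lact U W = (\<lambda>i. \<Sum>j\<in>UNIV. U $ i $ j *\<^sub>R W j)"

lemma lact_mult: "lact (U ** V) W = lact U (lact V W)"
proof
  fix i
  have "lact (U ** V) W i = (\<Sum>j\<in>UNIV. \<Sum>k\<in>UNIV. (U $ i $ k * V $ k $ j) *\<^sub>R W j)"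
    by (simp add: lact_def matrix_matrix_mult_def scaleR_sum_left)
  also have "\<dots> = lact U (lact V W) i"
    by (subst sum.swap) (simp add: lact_def scaleR_sum_right)
  finally show "lact (U ** V) W i = lact U (lact V W) i" .
qed

lemma lact_id [simp]: "lact (mat 1) W = W"
  by (simp add: lact_def mat_def if_distrib[of "\<lambda>x. x *\<^sub>R _"] cong: if_cong)

lemma lact_Sperp: "lact (Sperp i) W = lmove i W"
proof
  fix r
  have "lact (Sperp i) W r = (\<Sum>c\<in>UNIV. (if c = i then (if r = i then - W c else 2 *\<^sub>R W c) else 0)
      + (if c = r then (if r = i then 0 else W c) else 0))"
    unfolding lact_def by (intro sum.cong) (auto simp: Sperp_def)
  then show "lact (Sperp i) W r = lmove i W r"
    by (simp add: sum.distrib lmove_def)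
qed

lemma lact_Dmat: "lact Dmat W = ldual W"
proof
  fix r
  have "lact Dmat W r = (\<Sum>c\<in>UNIV. (1 / 2) *\<^sub>R W c - (if c = r then W c else 0))"
    unfolding lact_def
    by (intro sum.cong) (auto simp: Dmat_def prod_eq_iff vec_eq_iff)
  then show "lact Dmat W r = ldual W r"
    by (simp add: sum_subtractf ldual_def scaleR_sum_right)
qed

lemma Wmat_eq_iff: "Wmat D = U ** Wmat D0 \<longleftrightarrow> oc_vecs D = lact U (oc_vecs D0)"
proof -
  have "(U ** Wmat D0) $ i = (\<Sum>j\<in>UNIV. U $ i $ j *\<^sub>R wvec (D0 $ j))" for i
    by (simp add: vec_eq_iff matrix_matrix_mult_def Wmat_def)
  moreover have "Wmat D $ i = wvec (D $ i)" for i by (simp add: Wmat_def)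
  ultimately have "Wmat D = U ** Wmat D0 \<longleftrightarrow>
      (\<forall>i. wvec (D $ i) = (\<Sum>j\<in>UNIV. U $ i $ j *\<^sub>R wvec (D0 $ j)))"
    by (simp only: vec_eq_iff[of "Wmat D"])
  also have "\<dots> \<longleftrightarrow> (\<forall>i. lorentz (wvec (D $ i)) = (\<Sum>j\<in>UNIV. U $ i $ j *\<^sub>R lorentz (wvec (D0 $ j))))"
    by (simp add: lorentz_sum lorentz_scaleR flip: lorentz_eq_iff)
  finally show ?thesis by (simp add: oc_vecs_def oc_vec_def lact_def fun_eq_iff)
qed

lemma Sperp_involution: "Sperp i ** Sperp i = mat 1"
proof -
  have "(\<Sum>k\<in>UNIV. Sperp i $ r $ k * Sperp i $ k $ c) = (if r = c then 1 else 0)" for r c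
  proof -
    have "(\<Sum>k\<in>UNIV. Sperp i $ r $ k * Sperp i $ k $ c)
      = (\<Sum>k\<in>UNIV. (if k = i then Sperp i $ r $ i * Sperp i $ i $ c else 0)
        + (if k = r then (if r = i then 0 else Sperp i $ r $ c) else 0))"
      by (intro sum.cong) (auto simp: Sperp_def)
    then show ?thesis by (auto simp: sum.distrib Sperp_def)
  qed
  then show ?thesis by (simp add: vec_eq_iff matrix_matrix_mult_def mat_def)
qed

lemma matrix_inv_eqI:
  fixes U V :: "'a::semiring_1^'n^'n"
  assumes "U ** V = mat 1" "V ** U = mat 1"
  shows "matrix_inv U = V"
proof -
  have "\<exists>V. U ** V = mat 1 \<and> V ** U = mat 1" using assms by blast
  then have inv: "matrix_inv U ** U = mat 1"
    unfolding matrix_inv_def by (rule someI2_ex) blast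
  have "matrix_inv U = matrix_inv U ** (U ** V)" by (simp add: assms(1))
  also have "\<dots> = V" unfolding matrix_mul_assoc inv by simp
  finally show ?thesis .
qed

lemma lact_Aperp_lorbit:
  assumes "U \<in> Aperp"
  shows "lact U W \<in> lorbit W"
proof -
  \<comment> \<open>To pass the \<open>inv\<close> rule, the induction also carries a two-sided
    inverse whose action stays in the orbit.\<close>
  have "(\<forall>W. lact U W \<in> lorbit W) \<and>
      (\<exists>V. U ** V = mat 1 \<and> V ** U = mat 1 \<and> (\<forall>W. lact V W \<in> lorbit W))"
    using assms
  proof induction
    case id
    show ?case by (intro conjI exI[of _ "mat 1"]) (simp_all add: lorbit_refl)
  next
    case (gen i)
    show ?case
      by (intro conjI exI[of _ "Sperp i"])
        (simp_all add: lact_Sperp Sperp_involution lorbit_step lorbit_refl)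
  next
    case (mult U V)
    then obtain U' V' where U: "U ** U' = mat 1" "U' ** U = mat 1" "\<And>W. lact U' W \<in> lorbit W"
      and V: "V ** V' = mat 1" "V' ** V = mat 1" "\<And>W. lact V' W \<in> lorbit W"
      by blast
    have "(U ** V) ** (V' ** U') = U ** (V ** V') ** U'" "(V' ** U') ** (U ** V) = V' ** (U' ** U) ** V"
      by (simp_all add: matrix_mul_assoc)
    then have "(U ** V) ** (V' ** U') = mat 1" "(V' ** U') ** (U ** V) = mat 1"
      by (simp_all add: U V)
    moreover have "lact (U ** V) W \<in> lorbit W" "lact (V' ** U') W \<in> lorbit W" for W
      using lorbit_trans mult.IH U(3) V(3) unfolding lact_mult by blast+
    ultimately show ?case by blast
  next
    case (inv U)
    then show ?case using matrix_inv_eqI by metis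
  qed
  then show ?thesis by blast
qed

lemma lorbit_eq_lact_Aperp: "lorbit W = {lact U W | U. U \<in> Aperp}"
proof
  show "lorbit W \<subseteq> {lact U W | U. U \<in> Aperp}"
  proof
    fix V assume "V \<in> lorbit W"
    then show "V \<in> {lact U W | U. U \<in> Aperp}"
    proof induction
      case lorbit_refl
      show ?case using Aperp.id lact_id by (metis (mono_tags, lifting) mem_Collect_eq)
    next
      case (lorbit_step V i)
      then obtain U where "U \<in> Aperp" "V = lact U W" by blast
      then have "Sperp i ** U \<in> Aperp" "lmove i V = lact (Sperp i ** U) W"
        by (auto intro: Aperp.intros simp: lact_mult lact_Sperp)
      then show ?case by blast
    qed
  qed
qed (auto intro: lact_Aperp_lorbit)

lemma oc_vecs_orbit_Aperp:
  assumes "descartes D0"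
  shows "oc_vecs ` orbit_Aperp D0 = lorbit (oc_vecs D0)"
proof
  show "oc_vecs ` orbit_Aperp D0 \<subseteq> lorbit (oc_vecs D0)"
    by (auto simp: orbit_Aperp_def Wmat_eq_iff lact_Aperp_lorbit)
  show "lorbit (oc_vecs D0) \<subseteq> oc_vecs ` orbit_Aperp D0"
  proof
    fix V assume V: "V \<in> lorbit (oc_vecs D0)"
    then obtain U where "U \<in> Aperp" "V = lact U (oc_vecs D0)"
      unfolding lorbit_eq_lact_Aperp by blast
    moreover obtain D where "descartes D" "oc_vecs D = V"
      using descartes_realize lconf_lorbit[OF V lconf_oc_vecs[OF assms]] by blast
    ultimately have "D \<in> orbit_Aperp D0" "V = oc_vecs D"
      unfolding orbit_Aperp_def Wmat_eq_iff by auto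
    then show "V \<in> oc_vecs ` orbit_Aperp D0" by blast
  qed
qed

section \<open>Apollonian steps on dual configurations\<close>

text \<open>Besides \<open>W i\<close>, only one vector completes the other three to a Descartes configuration:
  by \<open>lconf_lform_square\<close> its product with \<open>W i\<close> is \<open>1\<close> or \<open>- 7\<close>.\<close>

lemma lconf_replace:
  assumes W: "lconf W" and V: "lconf V" and same: "\<And>j. j \<noteq> i \<Longrightarrow> V j = W j" and ne: "V i \<noteq> W i"
  shows "V = lswap i W"
proof -
  define g where "g = lform (V i) (W i)"
  have f: "lform (V i) (W j) = (if j = i then g else - 1)" for j
    using lconf_diff[OF V, of i j] same[of j] by (auto simp: g_def)
  have sums: "(\<Sum>j\<in>UNIV. if j = i then x else y) = x + 3 * y" for x y :: real
  proof -
    have "(\<Sum>j\<in>UNIV. if j = i then x else y) = (\<Sum>j\<in>UNIV. (if j = i then x - y else 0) + y)"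
      by (intro sum.cong) auto
    then show ?thesis by (simp add: sum.distrib)
  qed
  have "(\<Sum>j\<in>UNIV. (lform (V i) (W j))\<^sup>2) = g\<^sup>2 + 3"
    using sums[of "g\<^sup>2" 1] by (simp add: f if_distrib[of "\<lambda>x. x\<^sup>2"] cong: if_cong)
  moreover have "(\<Sum>j\<in>UNIV. lform (V i) (W j)) = g - 3"
    using sums[of g "- 1"] by (simp add: f)
  ultimately have "4 = 2 * (g\<^sup>2 + 3) - (g - 3)\<^sup>2"
    using lconf_lform_square[OF W, of "V i"] lconf_same[OF V] by simp
  then have "(g - 1) * (g + 7) = 0" by (simp add: power2_eq_square algebra_simps)
  moreover have "g \<noteq> 1"
  proof
    assume "g = 1"
    then have "V i = W i"
      using W by (intro lconf_eqI[OF W]) (auto simp: f lconf_def)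
    then show False using ne by simp
  qed
  ultimately have g: "g = - 7" by simp
  have "V i = lswap i W i"
  proof (rule lconf_eqI[OF W])
    fix j
    show "lform (V i) (W j) = lform (lswap i W i) (W j)"
      using W lconf_lform_sum[OF W, of j] by (auto simp: f g lswap_def lconf_def)
  qed
  then show ?thesis using same by (auto simp: lswap_def fun_eq_iff)
qed

text \<open>The new vector has products \<open>- 7\<close> with \<open>W i\<close> and
  \<open>- 1\<close> with \<open>W j\<close>, so its circle misses the tangency point of these
  two.\<close>

lemma lpts_lswap_neq:
  assumes "lconf W"
  shows "lpts (lswap i W i) \<noteq> lpts (W i)"
proof -
  obtain j where j: "j \<noteq> i" using ex_other by blast
  have "ltangent W i j \<in> lpts (W i)" using lpts_Int[OF assms, of i j] j by auto
  moreover have "ltangent W i j \<notin> lpts (lswap i W i)"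
    using j assms lconf_lform_sum[OF assms]
    by (simp add: ltangent_in_lpts lswap_def lconf_def)
  ultimately show ?thesis by blast
qed

lemma apoll_reach_descartes:
  assumes "E \<in> apoll_reach D" "descartes D"
  shows "descartes E"
  using assms by induction auto

text \<open>Uniqueness of the replacement (\<open>lconf_replace\<close>) turns each Apollonian step
  into a move of \<open>W\<close> through \<open>ldual_lmove\<close>; conversely, each move is
  realized by exchanging one circle.\<close>

lemma oc_vecs_apoll_reach:
  assumes D: "descartes D" and W: "lconf W" and dual: "oc_vecs D = ldual W"
  shows "oc_vecs ` apoll_reach D = ldual ` lorbit W"
proof
  have "oc_vecs E \<in> ldual ` lorbit W" if "E \<in> apoll_reach D" for E
    using that
  proof induction
    case base
    then show ?case using dual lorbit_refl by blast
  next
    case (step E E' i)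
    then obtain V where V: "V \<in> lorbit W" "oc_vecs E = ldual V" by blast
    have E: "descartes E" using apoll_reach_descartes[OF step.hyps(1) D] .
    have "oc_vecs E' i \<noteq> oc_vecs E i"
      using step.hyps pts_descartes[OF E] pts_descartes[of E'] by auto
    then have "oc_vecs E' = lswap i (oc_vecs E)"
      using step.hyps E by (intro lconf_replace lconf_oc_vecs) (auto simp: oc_vecs_def)
    then have "oc_vecs E' = ldual (lmove i V)" using V by (simp add: ldual_lmove)
    then show ?case using V(1) lorbit_step by blast
  qed
  then show "oc_vecs ` apoll_reach D \<subseteq> ldual ` lorbit W" by blast
  have "ldual V \<in> oc_vecs ` apoll_reach D" if "V \<in> lorbit W" for V
    using that
  proof induction
    case lorbit_refl
    then show ?case using dual apoll_reach.base by (metis image_eqI)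
  next
    case (lorbit_step V i)
    then obtain E where E: "E \<in> apoll_reach D" "oc_vecs E = ldual V" by (metis imageE)
    have dE: "descartes E" using apoll_reach_descartes[OF E(1) D] .
    have conf: "lconf (ldual (lmove i V))"
      using lconf_lorbit[OF lorbit_step.hyps W] by (intro lconf_ldual lconf_lmove)
    \<comment> \<open>A step must keep the other three circles of \<open>E\<close> as they are, so
      only entry \<open>i\<close> is realized anew.\<close>
    obtain C where C: "valid_oc C" "oc_vec C = ldual (lmove i V) i"
      using oc_vec_surj lconf_same[OF conf] by blast
    define E' where "E' = (\<chi> j. if j = i then C else E $ j)"
    have vecs: "oc_vecs E' = ldual (lmove i V)"
    proof
      fix j
      show "oc_vecs E' j = ldual (lmove i V) j"
        using C(2) fun_cong[OF E(2), of j]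
        by (cases "j = i") (simp_all add: oc_vecs_def E'_def ldual_lmove_other)
    qed
    have dE': "descartes E'"
      using C(1) descartes_valid[OF dE] conf vecs by (intro descartesI) (auto simp: E'_def)
    have "pts (E' $ i) \<noteq> pts (E $ i)"
      using lpts_lswap_neq[OF lconf_oc_vecs[OF dE], of i] E(2)
      by (simp add: pts_descartes dE dE' vecs ldual_lmove)
    then have "E' \<in> apoll_reach D"
      using E(1) dE' by (intro apoll_reach.step[of E _ E' i]) (auto simp: E'_def)
    then show ?case using vecs by (metis image_eqI)
  qed
  then show "ldual ` lorbit W \<subseteq> oc_vecs ` apoll_reach D" by blast
qed

theorem theorem5p3:
  fixes D0 D0perp :: "ocircle^4"
  assumes "descartes D0"
    and "descartes D0perp"
    and "Wmat D0perp = Dmat ** Wmat D0"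
  shows "closure (Sigma_pts D0) = residual_set D0perp"
proof -
  let ?W = "oc_vecs D0"
  have W: "lconf ?W" using lconf_oc_vecs[OF assms(1)] .
  have dual: "oc_vecs D0perp = ldual ?W"
    using assms(3) by (simp add: Wmat_eq_iff lact_Dmat)
  have pts: "pts (D $ i) = lpts (oc_vecs D i)" if "D \<in> orbit_Aperp D0" for D i
    using that pts_descartes by (simp add: orbit_Aperp_def)
  \<comment> \<open>Both sides are rewritten over the common orbit \<open>lorbit ?W\<close>, where
    \<open>closure_intersections_eq\<close> applies.\<close>
  have "Sigma_pts D0 = {p. \<exists>U\<in>lorbit ?W. \<exists>V\<in>lorbit ?W. \<exists>i j.
      lpts (U i) \<noteq> lpts (V j) \<and> p \<in> lpts (U i) \<and> p \<in> lpts (V j)}"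
    unfolding Sigma_pts_def oc_vecs_orbit_Aperp[OF assms(1), symmetric] bex_simps
    by (intro Collect_cong bex_cong refl) (simp add: pts)
  moreover have "(\<Union>C\<in>apoll_packing D0perp. pts C) = (\<Union>E\<in>apoll_reach D0perp. \<Union>k. pts (E $ k))"
    by (auto simp: apoll_packing_def)
  moreover have "\<dots> = (\<Union>E\<in>apoll_reach D0perp. \<Union>k. lpts (oc_vecs E k))"
    using apoll_reach_descartes[OF _ assms(2)] by (simp add: pts_descartes)
  moreover have "\<dots> = (\<Union>V\<in>oc_vecs ` apoll_reach D0perp. \<Union>k. lpts (V k))" by simp
  moreover have "\<dots> = (\<Union>V\<in>lorbit ?W. \<Union>k. lpts (ldual V k))"
    unfolding oc_vecs_apoll_reach[OF assms(2) W dual] by simp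
  ultimately show ?thesis
    unfolding residual_set_def using closure_intersections_eq[OF W] by metis
qed

end
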